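(* Let $E=(\mathbb R^n,\|\cdot\|_E)$ be a real Banach space of dimension $n$ and let $0<p<2$. Then $$M_p(B_E,d_2)\le\mathfrak m_p\,b_p^{(n)}\int_{S^{n-1}}\|t\|_{E'}^p\,d\lambda(t),\qquad b_p^{(n)}=\frac{\pi^{1/2}\,\Gamma\left(\frac{n+p}{2}\right)}{\Gamma\left(\frac{p+1}{2}\right)\Gamma\left(\frac n2\right)},$$ where $E'$ denotes the dual of $E$.
   Context: $B_E$ is the closed unit ball of $E$; $d_2(x,y)=\|x-y\|_2$ is the Euclidean distance on $\mathbb R^n$; $\lambda$ is the normalized surface (rotation invariant probability) measure on the Euclidean sphere $S^{n-1}$; the dual is identified with $\mathbb R^n$ via the standard inner product, so $\|t\|_{E'}=\sup_{x\in B_E}|\langle x,t\rangle|$. For a compact set $K\subset\mathbb R^n$, $\mathfrak M^1(K)$ is the set of finite signed Borel measures $\mu$ on $K$ with $\mu(K)=1$, and $M_p(K,d_2)=\sup\{\int_K\int_K\|x-y\|_2^p\,d\mu(x)d\mu(y):\mu\in\mathfrak M^1(K)\}$. Also $\mathfrak m_p:=M_p([-1,1],d_2)=\sup\{\int_{-1}^1\int_{-1}^1|u-v|^p\,d\mu(u)d\mu(v):\mu\in\mathfrak M^1([-1,1])\}$. *)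

theory Defs
  imports "HOL-Probability.Probability"
begin

section \<open>Finite signed measures\<close>

text \<open>
  A finite signed measure on a measurable space (of which only \<open>space M\<close> and \<open>sets M\<close> matter) is a
  countably additive real-valued set function; its values outside \<open>sets M\<close> are irrelevant.
\<close>

definition signed_measure :: "'a measure \<Rightarrow> ('a set \<Rightarrow> real) \<Rightarrow> bool" where
  "signed_measure M \<mu> \<longleftrightarrow>
     \<mu> {} = 0 \<and>
     (\<forall>A :: nat \<Rightarrow> 'a set. range A \<subseteq> sets M \<longrightarrow> disjoint_family A \<longrightarrow>
        (\<lambda>i. \<mu> (A i)) sums \<mu> (\<Union>i. A i))"

text \<open>
  The positive part \<open>\<mu>\<^sup>+(A) = sup {\<mu>(B) | B \<subseteq> A measurable}\<close> of the Jordan decomposition; the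
  negative part of \<open>\<mu>\<close> is the positive part of \<open>-\<mu>\<close>.  The truncation of negative reals by
  \<open>ennreal\<close> does no harm, because \<open>B = {}\<close> contributes the value \<open>0\<close> to the supremum.
\<close>

definition pos_part_measure :: "'a measure \<Rightarrow> ('a set \<Rightarrow> real) \<Rightarrow> 'a measure" where
  "pos_part_measure M \<mu> =
     measure_of (space M) (sets M) (\<lambda>A. SUP B\<in>{B \<in> sets M. B \<subseteq> A}. ennreal (\<mu> B))"

definition signed_integral :: "'a measure \<Rightarrow> ('a set \<Rightarrow> real) \<Rightarrow> ('a \<Rightarrow> real) \<Rightarrow> real" where
  "signed_integral M \<mu> f =
     (LINT x|pos_part_measure M \<mu>. f x) - (LINT x|pos_part_measure M (\<lambda>A. - \<mu> A). f x)"

section \<open>The energy constants\<close>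

definition signed_prob :: "'a::metric_space set \<Rightarrow> ('a set \<Rightarrow> real) set" where
  "signed_prob K = {\<mu>. signed_measure (restrict_space borel K) \<mu> \<and> \<mu> K = 1}"

definition energy :: "real \<Rightarrow> 'a::metric_space set \<Rightarrow> ('a set \<Rightarrow> real) \<Rightarrow> real" where
  "energy p K \<mu> =
     signed_integral (restrict_space borel K) \<mu>
       (\<lambda>y. signed_integral (restrict_space borel K) \<mu> (\<lambda>x. dist x y powr p))"

text \<open>
  The metric is the one of the type, so it is \<open>\<bar>u - v\<bar>\<close> on \<open>real\<close> and the Euclidean distance on
  \<open>real ^ 'n\<close>.  The supremum is taken in the extended reals, since it need not be finite a priori.
\<close>

definition max_energy :: "real \<Rightarrow> 'a::metric_space set \<Rightarrow> ereal" where
  "max_energy p K = (SUP \<mu>\<in>signed_prob K. ereal (energy p K \<mu>))"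

definition \<mm> :: "real \<Rightarrow> ereal" where
  "\<mm> p = max_energy p {-1..1::real}"

section \<open>Norms, the dual norm, and the rotation invariant measure\<close>

definition is_norm :: "('a::real_vector \<Rightarrow> real) \<Rightarrow> bool" where
  "is_norm N \<longleftrightarrow>
     (\<forall>x. 0 \<le> N x) \<and> (\<forall>x. N x = 0 \<longleftrightarrow> x = 0) \<and>
     (\<forall>c x. N (c *\<^sub>R x) = \<bar>c\<bar> * N x) \<and> (\<forall>x y. N (x + y) \<le> N x + N y)"

definition unit_ball :: "('a::real_vector \<Rightarrow> real) \<Rightarrow> 'a set" where
  "unit_ball N = {x. N x \<le> 1}"

definition dual_norm :: "('a::real_inner \<Rightarrow> real) \<Rightarrow> 'a \<Rightarrow> real" where
  "dual_norm N t = (SUP x\<in>unit_ball N. \<bar>x \<bullet> t\<bar>)"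

text \<open>
  Invariance is required under the full orthogonal group; this makes the measure unique in every
  dimension, including dimension one, where it forces mass \<open>1/2\<close> on each of the points \<open>1, -1\<close>.
\<close>

definition rotation_invariant_prob :: "'a::euclidean_space measure \<Rightarrow> bool" where
  "rotation_invariant_prob L \<longleftrightarrow>
     prob_space L \<and> sets L = sets (restrict_space borel (sphere 0 1)) \<and>
     (\<forall>f. orthogonal_transformation f \<longrightarrow> distr L L f = L)"

definition b_const :: "real \<Rightarrow> nat \<Rightarrow> real" where
  "b_const p n = sqrt pi * Gamma ((real n + p) / 2) / (Gamma ((p + 1) / 2) * Gamma (real n / 2))"

text \<open>
  Lebesgue measure is invariant under orthogonal transformations of any Euclidean space (the
  library's \<open>measure_orthogonal_image\<close> needs a well-ordered index type): an open set
  is, up to a null set, a countable disjoint union of balls, and balls are mapped to balls.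
\<close>

lemma emeasure_open_orthogonal_image_le:
  fixes f :: "'a::euclidean_space \<Rightarrow> 'a"
  assumes f: "orthogonal_transformation f" and U: "open U"
  shows "emeasure lborel U \<le> emeasure lborel (f ` U)"
proof -
  define K where "K = {(x, r). 0 < r \<and> ball x r \<subseteq> U}"
  have "\<exists>i. i \<in> K \<and> x \<in> ball (fst i) (snd i) \<and> snd i < d" if xU: "x \<in> U" "0 < d" for x d
  proof -
    obtain e where e: "0 < e" "ball x e \<subseteq> U" using U xU(1) by (meson openE)
    have "ball x (min e (d / 2)) \<subseteq> U" using e by auto
    then show ?thesis
      using e xU by (intro exI[of _ "(x, min e (d / 2))"]) (auto simp: K_def)
  qed
  then obtain C where C: "countable C" "C \<subseteq> K"
    and disj: "pairwise (\<lambda>i j. disjnt (ball (fst i) (snd i)) (ball (fst j) (snd j))) C"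
    and neg: "negligible (U - (\<Union>i\<in>C. ball (fst i) (snd i)))"
    by (rule Vitali_covering_theorem_balls[of U K fst snd])
  define V where "V = (\<Union>i\<in>C. ball (fst i) (snd i))"
  have inj: "inj f" using f by (rule orthogonal_transformation_inj)
  have fball: "f ` ball x r = ball (f x) r" for x r
    using f by (rule image_orthogonal_transformation_ball)
  have V_sub: "V \<subseteq> U" using C(2) unfolding V_def K_def by (fastforce simp del: mem_ball)
  have fV: "f ` V = (\<Union>i\<in>C. ball (f (fst i)) (snd i))"
    unfolding V_def by (simp add: image_UN fball)
  have fU: "open (f ` U)"
  proof -
    have "f ` U = \<Union> {ball (f x) r |x r. ball x r \<subseteq> U}"
    proof
      show "f ` U \<subseteq> \<Union> {ball (f x) r |x r. ball x r \<subseteq> U}"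
      proof
        fix y assume "y \<in> f ` U"
        then obtain x where x: "y = f x" "x \<in> U" by blast
        obtain e where "0 < e" "ball x e \<subseteq> U" using U x(2) by (meson openE)
        then show "y \<in> \<Union> {ball (f x) r |x r. ball x r \<subseteq> U}" using x(1) by force
      qed
      show "\<Union> {ball (f x) r |x r. ball x r \<subseteq> U} \<subseteq> f ` U"
        unfolding fball[symmetric] by blast
    qed
    then show ?thesis by auto
  qed
  have d1: "disjoint_family_on (\<lambda>i. ball (fst i) (snd i)) C"
    using disj by (auto simp: disjoint_family_on_def pairwise_def disjnt_def)
  then have d2: "disjoint_family_on (\<lambda>i. ball (f (fst i)) (snd i)) C"
    unfolding fball[symmetric] disjoint_family_on_def
    by (metis image_Int[OF inj] image_empty)
  have "open V" unfolding V_def by auto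
  then have "emeasure lborel U = emeasure lborel V"
  proof -
    have "U - V \<in> null_sets lebesgue"
      using neg by (simp add: V_def negligible_iff_null_sets)
    then have "U - V \<in> null_sets lborel"
      using U \<open>open V\<close> by (simp add: null_sets_def)
    then have "emeasure lborel (V \<union> (U - V)) = emeasure lborel V"
      using \<open>open V\<close> by (intro emeasure_Un_null_set) auto
    moreover have "V \<union> (U - V) = U" using V_sub by blast
    ultimately show ?thesis by simp
  qed
  also have "\<dots> = (\<integral>\<^sup>+i. emeasure lborel (ball (fst i) (snd i)) \<partial>count_space C)"
    unfolding V_def using C(1) d1 by (intro emeasure_UN_countable) auto
  also have "\<dots> = (\<integral>\<^sup>+i. emeasure lborel (ball (f (fst i)) (snd i)) \<partial>count_space C)"
    using C(2) by (intro nn_integral_cong) (auto simp: K_def emeasure_ball)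
  also have "\<dots> = emeasure lborel (f ` V)"
    unfolding fV using C(1) d2 by (intro emeasure_UN_countable[symmetric]) auto
  also have "\<dots> \<le> emeasure lborel (f ` U)"
    using V_sub fU by (intro emeasure_mono) auto
  finally show ?thesis .
qed

lemma distr_lborel_orthogonal:
  fixes f :: "'a::euclidean_space \<Rightarrow> 'a"
  assumes f: "orthogonal_transformation f"
  shows "distr lborel borel f = lborel"
proof (rule lborel_eqI[symmetric])
  have cont: "continuous_on UNIV f"
    using orthogonal_transformation_linear[OF f]
    by (intro linear_continuous_on) (simp add: linear_conv_bounded_linear)
  then have f_meas: "f \<in> measurable lborel borel"
    using borel_measurable_continuous_onI by simp
  fix l u :: 'a assume lu: "\<And>b. b \<in> Basis \<Longrightarrow> l \<bullet> b \<le> u \<bullet> b"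
  have pre: "open (f -` box l u)"
    using cont by (rule open_vimage[OF open_box])
  have img: "f ` (f -` box l u) = box l u"
    using orthogonal_transformation_surj[OF f] by (rule surj_image_vimage_eq)
  have inv_img: "inv f ` box l u = f -` box l u"
    using orthogonal_transformation_bij[OF f] by (rule bij_vimage_eq_inv_image[symmetric])
  have "emeasure lborel (f -` box l u) = emeasure lborel (box l u)"
    using emeasure_open_orthogonal_image_le[OF f pre]
      emeasure_open_orthogonal_image_le[OF orthogonal_transformation_inv[OF f] open_box[of l u]]
    unfolding img inv_img by simp
  then show "emeasure (distr lborel borel f) (box l u) = (\<Prod>b\<in>Basis. (u - l) \<bullet> b)"
    using f_meas lu by (simp add: emeasure_distr)
qed simp

text \<open>The invariant measure exists: project the uniform distribution on the ball radially.\<close>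

lemma rotation_invariant_prob_exists:
  "\<exists>L :: 'a::euclidean_space measure. rotation_invariant_prob L"
proof -
  define S where "S = (restrict_space borel (sphere 0 1) :: 'a measure)"
  define B where "B = ball (0 :: 'a) 1 - {0}"
  obtain e :: 'a where e: "norm e = 1"
    using vector_choose_size[of 1] by auto
  define h where "h = (\<lambda>x :: 'a. if x = 0 then e else x /\<^sub>R norm x)"
  define U where "U = uniform_measure lborel B"
  define L where "L = distr U S h"
  have B_sets [measurable]: "B \<in> sets borel" by (simp add: B_def)
  have emB: "emeasure lborel B = emeasure lborel (ball (0 :: 'a) 1)"
    unfolding B_def by (rule emeasure_Diff_null_set) auto
  have B_pos: "emeasure lborel B \<noteq> 0"
    unfolding emB by (simp add: emeasure_ball less_imp_neq[OF unit_ball_vol_pos, symmetric])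
  have B_fin: "emeasure lborel B \<noteq> \<infinity>"
    unfolding emB using emeasure_bounded_finite[OF bounded_ball, of "0 :: 'a" 1] by simp
  have U: "prob_space U" "sets U = sets borel" "space U = UNIV"
    unfolding U_def using B_pos B_fin by (auto intro: prob_space_uniform_measure)
  have h_borel: "h \<in> borel_measurable borel" unfolding h_def by measurable
  have h_sphere: "norm (h x) = 1" for x by (simp add: h_def e)
  have h_meas: "h \<in> measurable U S"
    using h_borel U h_sphere unfolding S_def
    by (auto intro!: measurable_restrict_space2 simp: measurable_cong_sets[OF U(2) refl])
  have L_sets: "sets L = sets S" by (simp add: L_def)
  have L_space: "space L = sphere 0 1" by (simp add: L_def S_def space_restrict_space)
  have "prob_space L"
    unfolding L_def using U(1) h_meas by (rule prob_space.prob_space_distr)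
  moreover have "distr L L f = L" if f: "orthogonal_transformation f" for f
  proof (rule measure_eqI)
    fix A assume "A \<in> sets (distr L L f)"
    then have A: "A \<in> sets S" by (simp add: L_sets)
    have lin: "linear f" using f by (rule orthogonal_transformation_linear)
    have nf: "norm (f x) = norm x" for x
      using f by (rule orthogonal_transformation_norm)
    have f_borel: "f \<in> borel_measurable borel"
      using lin by (intro borel_measurable_continuous_onI linear_continuous_on)
        (simp add: linear_conv_bounded_linear)
    have f_meas: "f \<in> measurable L L"
      using f_borel nf unfolding measurable_cong_sets[OF L_sets L_sets] S_def
      by (intro measurable_restrict_space3) auto
    have preA: "f -` A \<inter> space L \<in> sets S"
      using measurable_sets[OF f_meas] A L_sets by auto
    have em: "emeasure L C = emeasure lborel (B \<inter> h -` C) / emeasure lborel B"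
      and ms: "B \<inter> h -` C \<in> sets borel" if "C \<in> sets S" for C
    proof -
      have "h -` C \<inter> space U \<in> sets U" using h_meas that by (rule measurable_sets)
      then have hC: "h -` C \<in> sets borel" using U by simp
      then show "B \<inter> h -` C \<in> sets borel" by simp
      show "emeasure L C = emeasure lborel (B \<inter> h -` C) / emeasure lborel B"
        unfolding L_def using emeasure_distr[OF h_meas that] hC U(3)
        by (simp add: U_def)
    qed
    let ?P = "B \<inter> h -` (f -` A \<inter> space L)" and ?Q = "B \<inter> h -` A"
    have hf: "h (f x) = f (h x)" if "x \<in> B" for x
    proof -
      have "x \<noteq> 0" using that by (simp add: B_def)
      moreover then have "f x \<noteq> 0" using nf[of x] by auto
      ultimately show ?thesis
        using orthogonal_transformation_scaleR[OF f] by (simp add: h_def nf)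
    qed
    have fB: "f x \<in> B \<longleftrightarrow> x \<in> B" for x
    proof -
      have "f x = 0 \<longleftrightarrow> x = 0" by (metis nf norm_eq_zero)
      then show ?thesis by (simp add: B_def nf)
    qed
    have "?P = f -` ?Q"
      using hf fB h_sphere by (auto simp: L_space)
    moreover have "emeasure lborel (f -` ?Q) = emeasure (distr lborel borel f) ?Q"
      using ms[OF A] f_borel by (subst emeasure_distr) auto
    ultimately have "emeasure lborel ?P = emeasure lborel ?Q"
      using distr_lborel_orthogonal[OF f] by simp
    then show "emeasure (distr L L f) A = emeasure L A"
      using emeasure_distr[OF f_meas, of A] A em[OF A] em[OF preA] L_sets by simp
  qed simp
  ultimately have "rotation_invariant_prob L"
    by (simp add: rotation_invariant_prob_def L_sets S_def)
  then show ?thesis ..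
qed

end

(*
  Averaging over the sphere gives |x|^p = b_p * (integral of |<x, t>|^p dL(t)), the constant being
  found by integrating both sides against a Gaussian.  Hence the energy of a signed measure mu on
  the unit ball is the average over t of b_p times the energy of mu for the kernel |<x - y, t>|^p.
  The map x -> <x, t> / |t|_{E'} sends the unit ball into [-1, 1], so the latter energy is
  |t|_{E'}^p times the energy of a signed measure of mass 1 on [-1, 1], which is at most m_p.
*)
theory Submission
  imports Defs
begin

section \<open>Signed measures and their integrals\<close>

text \<open>The signed integral is defined through the Jordan parts of \<open>\<mu>\<close>, and
  these do not survive projection: positive and negative mass may land on the same point of the line
  and cancel, so the images of the Jordan parts are in general not the Jordan parts of the image.
  Hence the integral of a bounded function is first shown to be the same for every representation of
  \<open>\<mu>\<close> as a difference of two finite measures (\<open>signed_integral_eq\<close>).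
  From then on energies have the form \<open>diff_energy P Q k\<close>, four ordinary iterated
  integrals to which Fubini and change of variables apply one at a time. Boundedness of the unit
  ball keeps all kernels bounded, which provides integrability throughout. The Gaussian weight
  reveals the constant because it is both invariant under orthogonal maps and a product over the
  coordinates. Invariance reduces |<t, z>|^p to a coordinate, and the product structure then reduces
  the integral to dimension one. What remains is a Gamma moment in dimension n and one in dimension
  1; their quotient, after cancelling powers of sqrt pi, is b_p.\<close>

lemma signed_measure_sums:
  "signed_measure M \<mu> \<Longrightarrow> range A \<subseteq> sets M \<Longrightarrow> disjoint_family A \<Longrightarrow>
    (\<lambda>i. \<mu> (A i)) sums \<mu> (\<Union>i. A i)"
  unfolding signed_measure_def by blast

lemma signed_measure_Un:
  assumes "signed_measure M \<mu>" "A \<in> sets M" "B \<in> sets M" "A \<inter> B = {}"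
  shows "\<mu> (A \<union> B) = \<mu> A + \<mu> B"
proof -
  have "range (binaryset A B) \<subseteq> sets M" "disjoint_family (binaryset A B)"
    using assms by (auto simp: range_binaryset_eq disjoint_family_on_def binaryset_def)
  then have "(\<lambda>i. \<mu> (binaryset A B i)) sums \<mu> (A \<union> B)"
    using assms(1) UN_binaryset_eq[of A B] unfolding signed_measure_def by metis
  moreover have "(\<lambda>i. \<mu> (binaryset A B i)) sums (\<mu> A + \<mu> B)"
    using assms(1) by (intro binaryset_sums) (simp add: signed_measure_def)
  ultimately show ?thesis by (rule sums_unique2)
qed

lemma signed_measure_Diff:
  assumes "signed_measure M \<mu>" "A \<in> sets M" "B \<in> sets M" "B \<subseteq> A"
  shows "\<mu> (A - B) = \<mu> A - \<mu> B"
  using signed_measure_Un[OF assms(1,3), of "A - B"] assms by (simp add: Un_absorb1)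

lemma signed_measure_uminus:
  "signed_measure M \<mu> \<Longrightarrow> signed_measure M (\<lambda>A. - \<mu> A)"
  unfolding signed_measure_def by (auto intro: sums_minus)

text \<open>
  If \<open>\<mu>\<close> is unbounded on the subsets of \<open>A\<close>, then so it is on the subsets of some \<open>A' \<subseteq> A\<close> with
  \<open>\<bar>\<mu> (A - A')\<bar> \<ge> 1\<close>; iterating gives disjoint sets on which \<open>\<mu>\<close> is not summable.
\<close>

lemma signed_measure_bounded:
  assumes sm: "signed_measure M \<mu>"
  shows "\<exists>c. \<forall>B\<in>sets M. \<bar>\<mu> B\<bar> \<le> c"
proof (rule ccontr)
  assume unb: "\<not> ?thesis"
  define bad where "bad A \<longleftrightarrow> A \<in> sets M \<and> (\<forall>c. \<exists>B\<in>sets M. B \<subseteq> A \<and> c < \<bar>\<mu> B\<bar>)" for A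
  have bad_space: "bad (space M)"
    using unb unfolding bad_def by (meson not_le sets.sets_into_space sets.top)
  have bad_Un: "bad A \<or> bad B" if AB: "A \<in> sets M" "B \<in> sets M" "A \<inter> B = {}" "bad (A \<union> B)" for A B
  proof (rule ccontr)
    assume "\<not> ?thesis"
    then obtain a b where a: "\<And>C. C \<in> sets M \<Longrightarrow> C \<subseteq> A \<Longrightarrow> \<bar>\<mu> C\<bar> \<le> a"
      and b: "\<And>C. C \<in> sets M \<Longrightarrow> C \<subseteq> B \<Longrightarrow> \<bar>\<mu> C\<bar> \<le> b"
      using AB unfolding bad_def by (meson not_le)
    obtain C where C: "C \<in> sets M" "C \<subseteq> A \<union> B" "a + b < \<bar>\<mu> C\<bar>"
      using AB(4) unfolding bad_def by blast
    have "\<mu> ((C \<inter> A) \<union> (C \<inter> B)) = \<mu> (C \<inter> A) + \<mu> (C \<inter> B)"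
      using AB C by (intro signed_measure_Un[OF sm]) auto
    moreover have "(C \<inter> A) \<union> (C \<inter> B) = C" using C by auto
    ultimately have "\<mu> C = \<mu> (C \<inter> A) + \<mu> (C \<inter> B)" by metis
    moreover have "\<bar>\<mu> (C \<inter> A)\<bar> \<le> a" "\<bar>\<mu> (C \<inter> B)\<bar> \<le> b"
      using a b AB C by auto
    ultimately show False using C(3) by simp
  qed
  have step: "\<exists>A'. bad A' \<and> A' \<subseteq> A \<and> 1 \<le> \<bar>\<mu> (A - A')\<bar>" if "bad A" for A
  proof -
    \<comment> \<open>The margin \<open>\<bar>\<mu> A\<bar> + 1\<close> makes both
      \<open>\<bar>\<mu> B\<bar>\<close> and \<open>\<bar>\<mu> (A - B)\<bar>\<close> at least 1. So
      whichever of the two halves is bad and is kept, the discarded half has the required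
      size.\<close>
    have "\<exists>B\<in>sets M. B \<subseteq> A \<and> \<bar>\<mu> A\<bar> + 1 < \<bar>\<mu> B\<bar>"
      using that by (simp only: bad_def)
    then obtain B where B: "B \<in> sets M" "B \<subseteq> A" "\<bar>\<mu> A\<bar> + 1 < \<bar>\<mu> B\<bar>" by blast
    have A: "A \<in> sets M" using that by (simp add: bad_def)
    have d: "\<mu> (A - B) = \<mu> A - \<mu> B" using signed_measure_Diff[OF sm A B(1,2)] .
    have AB: "A - (A - B) = B" "B \<union> (A - B) = A" using B by auto
    have "bad B \<or> bad (A - B)"
      using bad_Un[OF B(1) sets.Diff[OF A B(1)] Diff_disjoint] AB(2) that by simp
    then show ?thesis
    proof
      assume "bad B"
      moreover have "1 \<le> \<bar>\<mu> (A - B)\<bar>" using B(3) d by linarith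
      ultimately show ?thesis using B(2) by blast
    next
      assume "bad (A - B)"
      moreover have "1 \<le> \<bar>\<mu> (A - (A - B))\<bar>" using B(3) AB(1) by simp
      ultimately show ?thesis by blast
    qed
  qed
  define next' where "next' A = (SOME A'. bad A' \<and> A' \<subseteq> A \<and> 1 \<le> \<bar>\<mu> (A - A')\<bar>)" for A
  have nx: "bad (next' A) \<and> next' A \<subseteq> A \<and> 1 \<le> \<bar>\<mu> (A - next' A)\<bar>" if "bad A" for A
    unfolding next'_def using step[OF that] by (rule someI_ex)
  define S where "S k = (next' ^^ k) (space M)" for k :: nat
  have S_bad: "bad (S k)" for k
    by (induction k) (use bad_space nx in \<open>auto simp: S_def\<close>)
  have S_Suc: "S (Suc k) = next' (S k)" for k by (simp add: S_def)
  have S_dec: "S j \<subseteq> S i" if "i \<le> j" for i j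
    by (rule lift_Suc_antimono_le[OF _ that]) (use nx S_bad S_Suc in auto)
  have "disjoint_family (\<lambda>k. S k - S (Suc k))"
    unfolding disjoint_family_on_def
  proof (intro ballI impI)
    fix i j :: nat assume "i \<noteq> j"
    then consider "Suc i \<le> j" | "Suc j \<le> i" by linarith
    then show "(S i - S (Suc i)) \<inter> (S j - S (Suc j)) = {}"
      by cases (use S_dec in blast)+
  qed
  moreover have "range (\<lambda>k. S k - S (Suc k)) \<subseteq> sets M"
    using S_bad by (auto simp: bad_def)
  ultimately have "(\<lambda>k. \<mu> (S k - S (Suc k))) sums \<mu> (\<Union>k. S k - S (Suc k))"
    using sm unfolding signed_measure_def by blast
  then have "(\<lambda>k. \<mu> (S k - S (Suc k))) \<longlonglongrightarrow> 0"
    by (intro summable_LIMSEQ_zero) (rule sums_summable)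
  from LIMSEQ_D[OF this zero_less_one] obtain k where "\<bar>\<mu> (S k - S (Suc k))\<bar> < 1"
    by auto
  with nx[OF S_bad[of k]] S_Suc[of k] show False by simp
qed

section \<open>The Jordan decomposition\<close>

definition pos_part :: "'a measure \<Rightarrow> ('a set \<Rightarrow> real) \<Rightarrow> 'a set \<Rightarrow> ennreal" where
  "pos_part M \<mu> A = (SUP B\<in>{B \<in> sets M. B \<subseteq> A}. ennreal (\<mu> B))"

lemma pos_part_mono: "A \<subseteq> B \<Longrightarrow> pos_part M \<mu> A \<le> pos_part M \<mu> B"
  unfolding pos_part_def by (intro SUP_subset_mono) auto

lemma pos_part_upper: "B \<in> sets M \<Longrightarrow> B \<subseteq> A \<Longrightarrow> ennreal (\<mu> B) \<le> pos_part M \<mu> A"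
  unfolding pos_part_def by (rule SUP_upper) auto

text \<open>Near-optimal subsets of the two disjoint sets are glued to a subset of the union. If one
  of them has negative measure, \<open>ennreal\<close> truncates its value to 0 and the other one
  alone gives the bound.\<close>

lemma pos_part_Un_ge:
  assumes sm: "signed_measure M \<mu>" and AB: "A \<inter> B = {}"
  shows "pos_part M \<mu> A + pos_part M \<mu> B \<le> pos_part M \<mu> (A \<union> B)"
proof -
  have *: "ennreal (\<mu> C) + ennreal (\<mu> D) \<le> pos_part M \<mu> (A \<union> B)"
    if C: "C \<in> sets M" "C \<subseteq> A" and D: "D \<in> sets M" "D \<subseteq> B" for C D
  proof (cases "0 \<le> \<mu> C \<and> 0 \<le> \<mu> D")
    case True
    have "C \<inter> D = {}" using C D AB by blast
    then have "ennreal (\<mu> C) + ennreal (\<mu> D) = ennreal (\<mu> (C \<union> D))"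
      using signed_measure_Un[OF sm C(1) D(1)] True by simp
    also have "\<dots> \<le> pos_part M \<mu> (A \<union> B)"
      using C D by (intro pos_part_upper) auto
    finally show ?thesis .
  next
    case False
    moreover have "ennreal (\<mu> C) \<le> pos_part M \<mu> (A \<union> B)" "ennreal (\<mu> D) \<le> pos_part M \<mu> (A \<union> B)"
      using C D by (auto intro!: pos_part_upper)
    ultimately show ?thesis by (auto simp: not_le ennreal_neg)
  qed
  have "pos_part M \<mu> A + ennreal (\<mu> D) \<le> pos_part M \<mu> (A \<union> B)"
    if D: "D \<in> sets M" "D \<subseteq> B" for D
    unfolding pos_part_def[of _ _ A]
    by (subst ennreal_SUP_add_left[symmetric]) (use * D in \<open>auto intro!: SUP_least\<close>)
  then have "(SUP D\<in>{D \<in> sets M. D \<subseteq> B}. pos_part M \<mu> A + ennreal (\<mu> D)) \<le> pos_part M \<mu> (A \<union> B)"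
    by (auto intro!: SUP_least)
  moreover have "{D \<in> sets M. D \<subseteq> B} \<noteq> {}" by blast
  ultimately show ?thesis
    unfolding pos_part_def[of _ _ B] by (simp add: ennreal_SUP_add_right)
qed

text \<open>Superadditivity on finite unions, monotonicity and a limit bound the series by the value
  at the union. Conversely a measurable \<open>B\<close> inside the union is cut into the pieces
  \<open>B \<inter> A i\<close>; their measures sum to \<open>\<mu> B\<close>, and each is at most
  \<open>pos_part M \<mu> (A i)\<close>.\<close>

lemma countably_additive_pos_part:
  assumes sm: "signed_measure M \<mu>"
  shows "countably_additive (sets M) (pos_part M \<mu>)"
  unfolding countably_additive_def
proof (intro allI impI)
  fix A :: "nat \<Rightarrow> _"
  assume A: "range A \<subseteq> sets M" and d: "disjoint_family A"
  have "(\<Sum>i<n. pos_part M \<mu> (A i)) \<le> pos_part M \<mu> (\<Union>i<n. A i)" for n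
  proof (induction n)
    case (Suc n)
    have "(\<Sum>i<Suc n. pos_part M \<mu> (A i)) \<le> pos_part M \<mu> (\<Union>i<n. A i) + pos_part M \<mu> (A n)"
      using Suc by (simp add: add_mono)
    also have "\<dots> \<le> pos_part M \<mu> ((\<Union>i<n. A i) \<union> A n)"
    proof (rule pos_part_Un_ge[OF sm])
      have "A i \<inter> A n = {}" if "i < n" for i
        using that by (intro disjoint_family_onD[OF d]) auto
      then show "(\<Union>i<n. A i) \<inter> A n = {}" by blast
    qed
    also have "(\<Union>i<n. A i) \<union> A n = (\<Union>i<Suc n. A i)" by (auto simp: lessThan_Suc)
    finally show ?case .
  qed simp
  then have "(\<Sum>i<n. pos_part M \<mu> (A i)) \<le> pos_part M \<mu> (\<Union>i. A i)" for n
    by (rule order_trans) (auto intro!: pos_part_mono)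
  then have "(\<Sum>i. pos_part M \<mu> (A i)) \<le> pos_part M \<mu> (\<Union>i. A i)"
    by (rule suminf_le_const[OF summableI])
  moreover have "ennreal (\<mu> B) \<le> (\<Sum>i. pos_part M \<mu> (A i))"
    if B: "B \<in> sets M" "B \<subseteq> (\<Union>i. A i)" for B
  proof -
    have "(\<lambda>i. \<mu> (B \<inter> A i)) sums \<mu> (\<Union>i. B \<inter> A i)"
    proof (rule signed_measure_sums[OF sm])
      show "range (\<lambda>i. B \<inter> A i) \<subseteq> sets M" using A B by auto
      show "disjoint_family (\<lambda>i. B \<inter> A i)"
        using d by (rule disjoint_family_on_bisimulation) auto
    qed
    moreover have "(\<Union>i. B \<inter> A i) = B" using B by auto
    ultimately have "(\<lambda>n. \<Sum>i<n. \<mu> (B \<inter> A i)) \<longlonglongrightarrow> \<mu> B" by (simp add: sums_def)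
    then have "(\<lambda>n. ennreal (\<Sum>i<n. \<mu> (B \<inter> A i))) \<longlonglongrightarrow> ennreal (\<mu> B)" by (rule tendsto_ennrealI)
    moreover have "ennreal (\<Sum>i<n. \<mu> (B \<inter> A i)) \<le> (\<Sum>i. pos_part M \<mu> (A i))" for n
    proof -
      \<comment> \<open>\<open>ennreal\<close> is additive on nonnegative reals only, so the
        summands are truncated at 0 before it is moved inside the sum.\<close>
      have "ennreal (\<Sum>i<n. \<mu> (B \<inter> A i)) \<le> ennreal (\<Sum>i<n. max 0 (\<mu> (B \<inter> A i)))"
        by (intro ennreal_leI sum_mono) auto
      also have "\<dots> = (\<Sum>i<n. ennreal (max 0 (\<mu> (B \<inter> A i))))"
        by (intro sum_ennreal[symmetric]) auto
      also have "\<dots> = (\<Sum>i<n. ennreal (\<mu> (B \<inter> A i)))"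
        by (intro sum.cong refl) (auto simp: max_def ennreal_neg)
      also have "\<dots> \<le> (\<Sum>i<n. pos_part M \<mu> (A i))"
        using A B by (intro sum_mono pos_part_upper) auto
      also have "\<dots> \<le> (\<Sum>i. pos_part M \<mu> (A i))" by (intro sum_le_suminf) auto
      finally show ?thesis .
    qed
    ultimately show ?thesis by (intro LIMSEQ_le_const2) auto
  qed
  then have "pos_part M \<mu> (\<Union>i. A i) \<le> (\<Sum>i. pos_part M \<mu> (A i))"
    unfolding pos_part_def[of _ _ "\<Union>i. A i"] by (auto intro: SUP_least)
  ultimately show "(\<Sum>i. pos_part M \<mu> (A i)) = pos_part M \<mu> (\<Union> (range A))"
    by (intro antisym)
qed

lemma sets_pos_part_measure [measurable_cong, simp]: "sets (pos_part_measure M \<mu>) = sets M"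
  unfolding pos_part_measure_def by (simp add: sets.space_closed)

lemma space_pos_part_measure [simp]: "space (pos_part_measure M \<mu>) = space M"
  unfolding pos_part_measure_def by (simp add: sets.space_closed)

text \<open>\<open>measure_of\<close> takes the values of the given set function only if that
  function is positive and countably additive, and is the zero measure otherwise. This is where the
  additivity of \<open>pos_part\<close> pays off.\<close>

lemma emeasure_pos_part_measure:
  assumes sm: "signed_measure M \<mu>" and A: "A \<in> sets M"
  shows "emeasure (pos_part_measure M \<mu>) A = pos_part M \<mu> A"
proof (rule emeasure_measure_of)
  show "pos_part_measure M \<mu> = measure_of (space M) (sets M) (pos_part M \<mu>)"
    unfolding pos_part_measure_def pos_part_def ..
  show "sets M \<subseteq> Pow (space M)" by (rule sets.space_closed)
  have "{B \<in> sets M. B \<subseteq> {}} = {{}}" by auto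
  then show "positive (sets (pos_part_measure M \<mu>)) (pos_part M \<mu>)"
    using sm by (simp add: positive_def pos_part_def signed_measure_def)
  show "countably_additive (sets (pos_part_measure M \<mu>)) (pos_part M \<mu>)"
    using countably_additive_pos_part[OF sm] by simp
  show "A \<in> sets (pos_part_measure M \<mu>)" using A by simp
qed

lemma finite_measure_pos_part_measure:
  assumes sm: "signed_measure M \<mu>"
  shows "finite_measure (pos_part_measure M \<mu>)"
proof
  obtain c where c: "\<And>B. B \<in> sets M \<Longrightarrow> \<bar>\<mu> B\<bar> \<le> c"
    using signed_measure_bounded[OF sm] by blast
  have "pos_part M \<mu> (space M) \<le> ennreal c"
    unfolding pos_part_def by (intro SUP_least ennreal_leI) (use c in fastforce)
  also have "\<dots> < \<infinity>" by simp
  finally show "emeasure (pos_part_measure M \<mu>) (space (pos_part_measure M \<mu>)) \<noteq> \<infinity>"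
    by (simp add: emeasure_pos_part_measure[OF sm])
qed

text \<open>For measurable \<open>B \<subseteq> A\<close>,
  \<open>\<mu> B = \<mu> A - \<mu> (A - B)\<close> is at most \<open>\<mu> A\<close> plus the
  negative part of \<open>A\<close>; the supremum over \<open>B\<close> gives one inequality. The
  same inequality for the negated measure is the other one.\<close>

lemma Jordan_decomposition:
  assumes sm: "signed_measure M \<mu>" and A: "A \<in> sets M"
  shows "\<mu> A = measure (pos_part_measure M \<mu>) A - measure (pos_part_measure M (\<lambda>A. - \<mu> A)) A"
proof -
  have le: "measure (pos_part_measure M \<nu>) A \<le> \<nu> A + measure (pos_part_measure M (\<lambda>A. - \<nu> A)) A"
    if sn: "signed_measure M \<nu>" for \<nu>
  proof -
    interpret P: finite_measure "pos_part_measure M \<nu>"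
      by (rule finite_measure_pos_part_measure[OF sn])
    interpret Q: finite_measure "pos_part_measure M (\<lambda>A. - \<nu> A)"
      by (rule finite_measure_pos_part_measure[OF signed_measure_uminus[OF sn]])
    have up: "- \<nu> B \<le> measure (pos_part_measure M (\<lambda>A. - \<nu> A)) A"
      if "B \<in> sets M" "B \<subseteq> A" for B
    proof -
      have "ennreal (- \<nu> B) \<le> ennreal (measure (pos_part_measure M (\<lambda>A. - \<nu> A)) A)"
        using pos_part_upper[OF that, of "\<lambda>A. - \<nu> A"]
          emeasure_pos_part_measure[OF signed_measure_uminus[OF sn] A]
        by (simp add: Q.emeasure_eq_measure)
      then show ?thesis by (simp add: ennreal_le_iff)
    qed
    \<comment> \<open>Required for leaving \<open>ennreal\<close>, which would replace a negative
      right-hand side by 0.\<close>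
    have 0: "0 \<le> \<nu> A + measure (pos_part_measure M (\<lambda>A. - \<nu> A)) A"
      using up[OF A] by simp
    have "\<nu> B \<le> \<nu> A + measure (pos_part_measure M (\<lambda>A. - \<nu> A)) A"
      if "B \<in> sets M" "B \<subseteq> A" for B
      using up[of "A - B"] signed_measure_Diff[OF sn A that] that A by auto
    then have "pos_part M \<nu> A \<le> ennreal (\<nu> A + measure (pos_part_measure M (\<lambda>A. - \<nu> A)) A)"
      unfolding pos_part_def by (intro SUP_least ennreal_leI) auto
    then have "ennreal (measure (pos_part_measure M \<nu>) A)
        \<le> ennreal (\<nu> A + measure (pos_part_measure M (\<lambda>A. - \<nu> A)) A)"
      using emeasure_pos_part_measure[OF sn A] by (simp add: P.emeasure_eq_measure)
    then show ?thesis using 0 by (simp add: ennreal_le_iff)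
  qed
  from le[OF sm] le[OF signed_measure_uminus[OF sm]] show ?thesis by simp
qed

section \<open>Integrals against a signed measure\<close>

text \<open>Stated additively because the extended integrals cannot be subtracted.\<close>

lemma nn_integral_add_measures_cong:
  assumes sets: "sets Q' = sets P" "sets P' = sets P" "sets Q = sets P"
    and eq: "\<And>A. A \<in> sets P \<Longrightarrow> emeasure P A + emeasure Q' A = emeasure P' A + emeasure Q A"
    and f: "f \<in> borel_measurable P"
  shows "(\<integral>\<^sup>+x. f x \<partial>P) + (\<integral>\<^sup>+x. f x \<partial>Q') = (\<integral>\<^sup>+x. f x \<partial>P') + (\<integral>\<^sup>+x. f x \<partial>Q)"
proof -
  note [measurable_cong] = sets
  have sp: "space Q' = space P" "space P' = space P" "space Q = space P"
    using sets by (auto dest: sets_eq_imp_space_eq)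
  show ?thesis using f
  proof (induction rule: borel_measurable_induct)
    case (cong f g)
    have "(\<integral>\<^sup>+x. f x \<partial>R) = (\<integral>\<^sup>+x. g x \<partial>R)" if "space R = space P" for R
      using cong that by (intro nn_integral_cong) auto
    then show ?case using cong sp by metis
  next
    case (set A)
    then show ?case using eq sets by simp
  next
    case (mult u c)
    then show ?case by (simp add: nn_integral_cmult distrib_left[symmetric])
  next
    case (add u v)
    then have "(\<integral>\<^sup>+x. v x + u x \<partial>P) + (\<integral>\<^sup>+x. v x + u x \<partial>Q') =
      ((\<integral>\<^sup>+x. v x \<partial>P) + (\<integral>\<^sup>+x. v x \<partial>Q')) + ((\<integral>\<^sup>+x. u x \<partial>P) + (\<integral>\<^sup>+x. u x \<partial>Q'))"
      by (simp add: nn_integral_add ac_simps)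
    also have "\<dots> = (\<integral>\<^sup>+x. v x + u x \<partial>P') + (\<integral>\<^sup>+x. v x + u x \<partial>Q)"
      unfolding add.IH using add.hyps by (simp add: nn_integral_add ac_simps)
    finally show ?case .
  next
    case (seq U)
    have *: "(\<integral>\<^sup>+x. (SUP i. U i) x \<partial>R) = (SUP i. \<integral>\<^sup>+x. U i x \<partial>R)" if "sets R = sets P" for R
      using seq that unfolding SUP_apply
      by (intro nn_integral_monotone_convergence_SUP) (auto simp: measurable_cong_sets[OF that refl])
    have inc: "incseq (\<lambda>i. \<integral>\<^sup>+x. U i x \<partial>R)" for R
      using seq(3) by (auto simp: incseq_def le_fun_def intro!: nn_integral_mono)
    show ?case
      unfolding *[OF refl] *[OF sets(1)] *[OF sets(2)] *[OF sets(3)]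
        ennreal_SUP_add[OF inc inc, symmetric] using seq.IH by simp
  qed
qed

lemma integrable_bounded:
  fixes f :: "'a \<Rightarrow> real"
  assumes "finite_measure R" "f \<in> borel_measurable R" "\<And>x. x \<in> space R \<Longrightarrow> \<bar>f x\<bar> \<le> c"
  shows "integrable R f"
  using assms by (intro finite_measure.integrable_const_bound[of R f c]) auto

text \<open>If \<open>P - Q\<close> and the difference of the Jordan parts are the same set
  function, then adding crosswise gives two equal positive measures, which have the same integrals.
  This frees the signed integral from the Jordan parts, so that images of measures can be used in
  their place.\<close>

lemma signed_integral_eq:
  assumes sm: "signed_measure M \<mu>"
    and P: "finite_measure P" "sets P = sets M" and Q: "finite_measure Q" "sets Q = sets M"
    and \<mu>: "\<And>A. A \<in> sets M \<Longrightarrow> \<mu> A = measure P A - measure Q A"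
    and f: "f \<in> borel_measurable M" and c: "\<And>x. x \<in> space M \<Longrightarrow> \<bar>f x\<bar> \<le> c"
  shows "signed_integral M \<mu> f = (LINT x|P. f x) - (LINT x|Q. f x)"
proof -
  let ?P = "pos_part_measure M \<mu>" and ?Q = "pos_part_measure M (\<lambda>A. - \<mu> A)"
  have fin: "finite_measure ?P" "finite_measure ?Q"
    using finite_measure_pos_part_measure sm signed_measure_uminus by blast+
  \<comment> \<open>Adding the bound \<open>c\<close> makes the integrand nonnegative, as the
    extended integrals require. The extra terms, \<open>c\<close> times a total mass, cancel at the
    end because the crosswise sums have equal mass.\<close>
  define g where "g = (\<lambda>x. f x + c)"
  have sp: "space P = space M" "space Q = space M"
    using P(2) Q(2) by (auto dest: sets_eq_imp_space_eq)
  have shift: "(LINT x|R. g x) = (LINT x|R. f x) + c * measure R (space M)"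
    and nn: "(\<integral>\<^sup>+x. ennreal (g x) \<partial>R) = ennreal (LINT x|R. g x)"
    and pos: "0 \<le> (LINT x|R. g x)"
    if R: "finite_measure R" "sets R = sets M" for R
  proof -
    interpret R: finite_measure R by fact
    have spR: "space R = space M" using R(2) by (rule sets_eq_imp_space_eq)
    have fR: "f \<in> borel_measurable R" using f by (simp add: measurable_cong_sets[OF R(2) refl])
    have int: "integrable R f" using integrable_bounded[OF R(1) fR] c spR by metis
    then show "(LINT x|R. g x) = (LINT x|R. f x) + c * measure R (space M)"
      unfolding g_def spR[symmetric] by simp
    have g0: "0 \<le> g x" if "x \<in> space R" for x using c[of x] that spR by (auto simp: g_def)
    then show "(\<integral>\<^sup>+x. ennreal (g x) \<partial>R) = ennreal (LINT x|R. g x)"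
      using int by (intro nn_integral_eq_integral) (auto simp: g_def)
    show "0 \<le> (LINT x|R. g x)" using g0 by (intro integral_nonneg_AE) auto
  qed
  have eqm: "measure ?P A + measure Q A = measure P A + measure ?Q A" if "A \<in> sets M" for A
    using Jordan_decomposition[OF sm that] \<mu>[OF that] by simp
  have "(\<integral>\<^sup>+x. ennreal (g x) \<partial>?P) + (\<integral>\<^sup>+x. ennreal (g x) \<partial>Q) =
      (\<integral>\<^sup>+x. ennreal (g x) \<partial>P) + (\<integral>\<^sup>+x. ennreal (g x) \<partial>?Q)"
  proof (rule nn_integral_add_measures_cong)
    show "(\<lambda>x. ennreal (g x)) \<in> borel_measurable ?P"
      using f unfolding g_def by measurable
    fix A assume "A \<in> sets ?P"
    then have "measure ?P A + measure Q A = measure P A + measure ?Q A"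
      by (intro eqm) simp
    then have "ennreal (measure ?P A + measure Q A) = ennreal (measure P A + measure ?Q A)"
      by simp
    then show "emeasure ?P A + emeasure Q A = emeasure P A + emeasure ?Q A"
      using fin P(1) Q(1) by (simp add: finite_measure.emeasure_eq_measure)
  qed (use P Q in auto)
  then have "(LINT x|?P. g x) + (LINT x|Q. g x) = (LINT x|P. g x) + (LINT x|?Q. g x)"
    using nn pos P Q fin by (simp add: ennreal_plus[symmetric] del: ennreal_plus)
  moreover have "c * measure ?P (space M) + c * measure Q (space M) =
      c * measure P (space M) + c * measure ?Q (space M)"
    using eqm[of "space M"] by (simp add: distrib_left[symmetric])
  ultimately show ?thesis
    using shift P Q fin unfolding signed_integral_def by simp
qed

lemma signed_integral_cong:
  assumes "\<And>x. x \<in> space M \<Longrightarrow> f x = g x"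
  shows "signed_integral M \<mu> f = signed_integral M \<mu> g"
  unfolding signed_integral_def using assms
  by (intro arg_cong2[where f = minus] Bochner_Integration.integral_cong refl) simp_all

lemma signed_measure_diff:
  assumes P: "finite_measure P" "sets P = sets M" and Q: "finite_measure Q" "sets Q = sets M"
  shows "signed_measure M (\<lambda>A. measure P A - measure Q A)"
  unfolding signed_measure_def
proof (intro conjI allI impI)
  fix A :: "nat \<Rightarrow> _" assume "range A \<subseteq> sets M" "disjoint_family A"
  then show "(\<lambda>i. measure P (A i) - measure Q (A i)) sums
      (measure P (\<Union>i. A i) - measure Q (\<Union>i. A i))"
    using P Q by (intro sums_diff finite_measure.finite_measure_UNION) auto
qed simp

section \<open>Energy of a difference of two measures\<close>

text \<open>The bilinear expansion of the double integral of \<open>k\<close> against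
  \<open>P - Q\<close>, nested in the same order as \<open>energy\<close>. The kernel is arbitrary
  in order to cover powers of the distance, their one-dimensional projections and averages of
  these.\<close>

definition diff_energy :: "'a measure \<Rightarrow> 'a measure \<Rightarrow> ('a \<Rightarrow> 'a \<Rightarrow> real) \<Rightarrow> real" where
  "diff_energy P Q k =
     ((LINT y|P. LINT x|P. k x y) - (LINT y|P. LINT x|Q. k x y))
     - ((LINT y|Q. LINT x|P. k x y) - (LINT y|Q. LINT x|Q. k x y))"

text \<open>The absolute value of \<open>c\<close> covers an empty space, on which the hypothesis
  leaves the sign of \<open>c\<close> open.\<close>

lemma integral_kernel_bounded:
  fixes k :: "'a \<Rightarrow> 'b \<Rightarrow> real"
  assumes B: "finite_measure B" and k: "\<And>x. x \<in> space B \<Longrightarrow> \<bar>k x y\<bar> \<le> c"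
  shows "\<bar>LINT x|B. k x y\<bar> \<le> \<bar>c\<bar> * measure B (space B)"
proof -
  interpret finite_measure B by fact
  have "\<bar>LINT x|B. k x y\<bar> \<le> (LINT x|B. \<bar>k x y\<bar>)" by (rule integral_abs_bound)
  also have "\<dots> \<le> (LINT x|B. \<bar>c\<bar>)"
    by (intro integral_mono_AE' AE_I2) (use k in force)+
  finally show ?thesis by (simp add: mult.commute)
qed

lemma borel_measurable_integral_kernel:
  fixes k :: "'a \<Rightarrow> 'b \<Rightarrow> real"
  assumes B: "finite_measure B" and k: "(\<lambda>(x, y). k x y) \<in> borel_measurable (B \<Otimes>\<^sub>M A)"
  shows "(\<lambda>y. LINT x|B. k x y) \<in> borel_measurable A"
proof -
  interpret finite_measure B by fact
  have "(\<lambda>(y, x). k x y) \<in> borel_measurable (A \<Otimes>\<^sub>M B)"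
    using k by (subst measurable_pair_swap_iff) (simp add: case_prod_beta')
  then show ?thesis by (intro borel_measurable_lebesgue_integral) 
qed

lemma borel_measurable_dist_powr:
  fixes K :: "'a::{metric_space, second_countable_topology} set"
  shows "(\<lambda>(x, y). dist x y powr p)
      \<in> borel_measurable (restrict_space borel K \<Otimes>\<^sub>M restrict_space borel K)"
    and "(\<lambda>x. dist x y powr p) \<in> borel_measurable (restrict_space borel K)"
proof -
  have id: "(\<lambda>x. x) \<in> measurable (restrict_space borel K) borel"
    by (intro measurable_restrict_space1) simp
  show "(\<lambda>(x, y). dist x y powr p)
      \<in> borel_measurable (restrict_space borel K \<Otimes>\<^sub>M restrict_space borel K)"
    unfolding case_prod_beta'
    by (intro powr_real_measurable borel_measurable_const borel_measurable_dist
        measurable_compose[OF measurable_fst id] measurable_compose[OF measurable_snd id])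
  show "(\<lambda>x. dist x y powr p) \<in> borel_measurable (restrict_space borel K)"
    by (intro powr_real_measurable borel_measurable_const borel_measurable_dist id)
qed

text \<open>\<open>signed_integral_eq\<close> is applied twice, to the kernel and to its inner
  integral; the bounded set and the positive exponent make both integrands bounded. With
  \<open>P\<close> and \<open>Q\<close> left free, the result serves the Jordan parts on the unit
  ball as well as the images on the interval.\<close>

lemma energy_eq_diff_energy:
  fixes K :: "'a::{metric_space, second_countable_topology} set"
  assumes sm: "signed_measure (restrict_space borel K) \<mu>" and K: "bounded K" and p: "0 < p"
    and P: "finite_measure P" "sets P = sets (restrict_space borel K)"
    and Q: "finite_measure Q" "sets Q = sets (restrict_space borel K)"
    and \<mu>: "\<And>A. A \<in> sets (restrict_space borel K) \<Longrightarrow> \<mu> A = measure P A - measure Q A"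
  shows "energy p K \<mu> = diff_energy P Q (\<lambda>x y. dist x y powr p)"
proof -
  let ?M = "restrict_space borel K"
  let ?k = "\<lambda>x y :: 'a. dist x y powr p"
  obtain d where d: "\<And>x y. x \<in> K \<Longrightarrow> y \<in> K \<Longrightarrow> dist x y \<le> d"
    using K by (metis bounded_two_points)
  have kb: "\<bar>?k x y\<bar> \<le> d powr p" if "x \<in> K" "y \<in> K" for x y
    using d[OF that] p by (simp add: powr_mono2)
  have spM: "space ?M = K" by (simp add: space_restrict_space)
  note km = borel_measurable_dist_powr(1)[of p K] and kmy = borel_measurable_dist_powr(2)[of _ p K]
  have spR: "space R = K" if "sets R = sets ?M" for R :: "'a measure"
    using sets_eq_imp_space_eq[OF that] spM by simp
  have inner: "signed_integral ?M \<mu> (\<lambda>x. ?k x y) = (LINT x|P. ?k x y) - (LINT x|Q. ?k x y)"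
    if "y \<in> K" for y
    using signed_integral_eq[OF sm P Q \<mu> kmy, where c = "d powr p"] kb that spM by simp
  have im: "(\<lambda>y. LINT x|R. ?k x y) \<in> borel_measurable ?M"
    if R: "finite_measure R" "sets R = sets ?M" for R
    using km by (intro borel_measurable_integral_kernel[OF R(1)])
      (simp add: measurable_cong_sets[OF sets_pair_measure_cong[OF R(2) refl] refl])
  have ib: "\<bar>LINT x|R. ?k x y\<bar> \<le> \<bar>d powr p\<bar> * measure R (space R)"
    if R: "finite_measure R" "sets R = sets ?M" and y: "y \<in> K" for R y
    using kb y spR[OF R(2)] by (intro integral_kernel_bounded[OF R(1)]) auto
  define I where "I y = (LINT x|P. ?k x y) - (LINT x|Q. ?k x y)" for y
  have split: "(LINT y|R. I y) = (LINT y|R. LINT x|P. ?k x y) - (LINT y|R. LINT x|Q. ?k x y)"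
    if R: "finite_measure R" "sets R = sets ?M" for R
    unfolding I_def
    using ib[OF P] ib[OF Q] im[OF P] im[OF Q] spR[OF R(2)]
    by (intro Bochner_Integration.integral_diff integrable_bounded[OF R(1)])
      (auto simp: measurable_cong_sets[OF R(2) refl])
  have "energy p K \<mu> = signed_integral ?M \<mu> I"
    unfolding energy_def I_def by (rule signed_integral_cong) (simp add: inner spM)
  also have "\<dots> = (LINT y|P. I y) - (LINT y|Q. I y)"
  proof (rule signed_integral_eq[OF sm P Q \<mu>])
    show "I \<in> borel_measurable ?M"
      unfolding I_def using im P Q by (intro borel_measurable_diff) auto
    show "\<bar>I y\<bar> \<le> \<bar>d powr p\<bar> * measure P (space P) + \<bar>d powr p\<bar> * measure Q (space Q)"
      if "y \<in> space ?M" for y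
    proof -
      have "y \<in> K" using that spM by simp
      from ib[OF P this] ib[OF Q this] show ?thesis unfolding I_def by linarith
    qed
  qed auto
  finally show ?thesis
    unfolding diff_energy_def split[OF P] split[OF Q] .
qed

text \<open>Two applications of Fubini: \<open>t\<close> is moved past \<open>x\<close> for fixed
  \<open>y\<close>, and then past \<open>y\<close> for the kernel already integrated in
  \<open>x\<close>. A bounded kernel on finite measures is integrable at both stages.\<close>

lemma integral_triple_rotate:
  fixes h :: "'a \<Rightarrow> 'b \<Rightarrow> 'c \<Rightarrow> real"
  assumes A: "finite_measure A" and B: "finite_measure B" and L: "finite_measure L"
    and h: "(\<lambda>((y, x), t). h x y t) \<in> borel_measurable ((A \<Otimes>\<^sub>M B) \<Otimes>\<^sub>M L)"
    and c: "\<And>x y t. x \<in> space B \<Longrightarrow> y \<in> space A \<Longrightarrow> t \<in> space L \<Longrightarrow> \<bar>h x y t\<bar> \<le> c"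
  shows "(LINT y|A. LINT x|B. LINT t|L. h x y t) = (LINT t|L. LINT y|A. LINT x|B. h x y t)"
    and "integrable L (\<lambda>t. LINT y|A. LINT x|B. h x y t)"
proof -
  interpret A: finite_measure A by fact
  interpret B: finite_measure B by fact
  interpret L: finite_measure L by fact
  interpret BL: pair_sigma_finite B L ..
  interpret AL: pair_sigma_finite A L ..
  interpret FBL: finite_measure "B \<Otimes>\<^sub>M L"
    by (rule finite_measure_pair_measure) (fact B L)+
  interpret FAL: finite_measure "A \<Otimes>\<^sub>M L"
    by (rule finite_measure_pair_measure) (fact A L)+
  note h[measurable]
  have hy: "(\<lambda>(x, t). h x y t) \<in> borel_measurable (B \<Otimes>\<^sub>M L)" if [measurable]: "y \<in> space A" for y
  proof -
    have "(\<lambda>z. ((y, fst z), snd z)) \<in> measurable (B \<Otimes>\<^sub>M L) ((A \<Otimes>\<^sub>M B) \<Otimes>\<^sub>M L)"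
      using that by measurable
    from measurable_compose[OF this h] show ?thesis by (simp add: case_prod_beta')
  qed
  have "integrable (B \<Otimes>\<^sub>M L) (\<lambda>(x, t). h x y t)" if "y \<in> space A" for y
    using hy[OF that] c that
    by (intro integrable_bounded[OF FBL.finite_measure_axioms, of _ c]) (auto simp: space_pair_measure)
  then have inner: "(LINT x|B. LINT t|L. h x y t) = (LINT t|L. LINT x|B. h x y t)" if "y \<in> space A" for y
    using BL.Fubini_integral[of "\<lambda>x t. h x y t"] that by simp
  have gm: "(\<lambda>(y, t). LINT x|B. h x y t) \<in> borel_measurable (A \<Otimes>\<^sub>M L)"
  proof -
    have "(\<lambda>z. ((fst (fst z), snd z), snd (fst z))) \<in> measurable ((A \<Otimes>\<^sub>M L) \<Otimes>\<^sub>M B) ((A \<Otimes>\<^sub>M B) \<Otimes>\<^sub>M L)"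
      by measurable
    from measurable_compose[OF this h]
    have "(\<lambda>(z, x). h x (fst z) (snd z)) \<in> borel_measurable ((A \<Otimes>\<^sub>M L) \<Otimes>\<^sub>M B)"
      by (simp add: case_prod_beta')
    then show ?thesis
      unfolding case_prod_beta' by (intro B.borel_measurable_lebesgue_integral) (simp add: case_prod_beta')
  qed
  have gi: "integrable (A \<Otimes>\<^sub>M L) (\<lambda>(y, t). LINT x|B. h x y t)"
    using gm c by (intro integrable_bounded[OF FAL.finite_measure_axioms, of _ "\<bar>c\<bar> * measure B (space B)"])
      (auto simp: space_pair_measure intro!: integral_kernel_bounded[OF B, where k = "\<lambda>x _. h x _ _"])
  have "(LINT y|A. LINT x|B. LINT t|L. h x y t) = (LINT y|A. LINT t|L. LINT x|B. h x y t)"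
    by (intro Bochner_Integration.integral_cong refl inner)
  also have "\<dots> = (LINT t|L. LINT y|A. LINT x|B. h x y t)"
    using AL.Fubini_integral[OF gi] by simp
  finally show "(LINT y|A. LINT x|B. LINT t|L. h x y t) = (LINT t|L. LINT y|A. LINT x|B. h x y t)" .
  show "integrable L (\<lambda>t. LINT y|A. LINT x|B. h x y t)"
    using AL.integrable_snd[OF gi] by simp
qed

section \<open>Gaussian integrals and spherical averages\<close>

text \<open>The image of Lebesgue measure under the squared norm is determined by the volumes of
  balls. Taking the squared norm as the variable turns Gaussian moments into Gamma integrals without
  a further substitution.\<close>

lemma nn_integral_radial:
  fixes \<phi> :: "real \<Rightarrow> ennreal"
  assumes \<phi>: "\<phi> \<in> borel_measurable borel"
  defines "n \<equiv> real DIM('a::euclidean_space)"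
  shows "(\<integral>\<^sup>+(z::'a). \<phi> ((norm z)\<^sup>2) \<partial>lborel) =
    (\<integral>\<^sup>+u. \<phi> u * ennreal (indicator {0..} u * (n / 2 * unit_ball_vol n * u powr (n / 2 - 1))) \<partial>lborel)"
proof -
  have n: "0 < n" by (simp add: n_def)
  \<comment> \<open>The derivative in \<open>u\<close> of
    \<open>unit_ball_vol n * u powr (n / 2)\<close>, the volume of the ball of radius
    \<open>sqrt u\<close>, mirrored to \<open>v = - u\<close>.\<close>
  define \<rho> where "\<rho> v = ennreal (indicator {..0} v * (n / 2 * unit_ball_vol n * (- v) powr (n / 2 - 1)))" for v :: real
  have \<rho>_meas: "\<rho> \<in> borel_measurable borel" unfolding \<rho>_def by measurable
  have eq: "emeasure (distr lborel borel (\<lambda>z::'a. - (norm z)\<^sup>2)) {x<..} =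
      (if x < 0 then ennreal (unit_ball_vol n * (- x) powr (n / 2)) else 0)" for x
  proof -
    have "(\<lambda>z::'a. - (norm z)\<^sup>2) -` {x<..} = (if x < 0 then ball 0 (sqrt (- x)) else {})"
    proof (cases "x < 0")
      case True
      have "x < - (norm z)\<^sup>2 \<longleftrightarrow> norm z < sqrt (- x)" for z :: 'a
        using real_sqrt_less_iff[of "(norm z)\<^sup>2" "- x"] by (simp add: less_minus_iff)
      then show ?thesis using True by auto
    next
      case False
      have "\<not> x < - (norm z)\<^sup>2" for z :: 'a
        using False zero_le_power2[of "norm z"] by linarith
      then show ?thesis using False by auto
    qed
    moreover have "emeasure lborel (ball (0::'a) (sqrt (- x))) = ennreal (unit_ball_vol n * (- x) powr (n / 2))" if "x < 0"
    proof -
      have "sqrt (- x) ^ DIM('a) = sqrt (- x) powr n"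
        using that by (simp add: n_def powr_realpow)
      also have "\<dots> = (- x) powr (n / 2)"
        using that by (simp add: powr_half_sqrt[symmetric] powr_powr)
      finally show ?thesis using that by (simp add: emeasure_ball n_def)
    qed
    ultimately show ?thesis by (subst emeasure_distr) (auto)
  qed
  \<comment> \<open>The sign makes the sets \<open>{x<..}\<close> of finite measure, as \<open>measure_eqI_lessThan\<close> needs.\<close>
  have "distr lborel borel (\<lambda>z::'a. - (norm z)\<^sup>2) = density lborel \<rho>"
  proof (rule measure_eqI_lessThan)
    fix x :: real
    have "emeasure (density lborel \<rho>) {x<..} =
        (if x < 0 then ennreal (unit_ball_vol n * (- x) powr (n / 2)) else 0)"
    proof (cases "x < 0")
      case True
      have "((\<lambda>u. u powr (n / 2 - 1)) has_integral (- x) powr (n / 2 - 1 + 1) / (n / 2 - 1 + 1)) {0..- x}"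
        using True n by (intro has_integral_powr_from_0) auto
      then have "((\<lambda>u. n / 2 * unit_ball_vol n * u powr (n / 2 - 1)) has_integral
          n / 2 * unit_ball_vol n * ((- x) powr (n / 2 - 1 + 1) / (n / 2 - 1 + 1))) {0..- x}"
        by (rule has_integral_mult_right)
      then have hi: "((\<lambda>u. n / 2 * unit_ball_vol n * u powr (n / 2 - 1)) has_integral
          unit_ball_vol n * (- x) powr (n / 2)) {0..- x}"
        using n by simp
      have "emeasure (density lborel \<rho>) {x<..} = (\<integral>\<^sup>+v. \<rho> v * indicator {x<..} v \<partial>lborel)"
        using \<rho>_meas by (intro emeasure_density) auto
      also have "\<dots> = (\<integral>\<^sup>+u. \<rho> (0 + (- 1) * u) * indicator {x<..} (0 + (- 1) * u) \<partial>lborel)"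
        using \<rho>_meas by (subst nn_integral_real_affine[where c = "- 1" and t = 0]) auto
      \<comment> \<open>The condition \<open>x < - u\<close> gives the half-open interval
        \<open>{0..<- x}\<close>; the closed one differs from it in the null set
        \<open>{- x}\<close>.\<close>
      also have "\<dots> = (\<integral>\<^sup>+u. ennreal (indicator {0..- x} u * (n / 2 * unit_ball_vol n * u powr (n / 2 - 1))) \<partial>lborel)"
        by (rule nn_integral_cong_AE, use AE_lborel_singleton[of "- x"] in eventually_elim)
          (auto simp: \<rho>_def indicator_def)
      also have "\<dots> = ennreal (unit_ball_vol n * (- x) powr (n / 2))"
        using n by (intro nn_integral_has_integral_lebesgue hi) auto
      finally show ?thesis using True by simp
    next
      case False
      have "emeasure (density lborel \<rho>) {x<..} = (\<integral>\<^sup>+v. \<rho> v * indicator {x<..} v \<partial>lborel)"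
        using \<rho>_meas by (intro emeasure_density) auto
      also have "\<dots> = (\<integral>\<^sup>+v. 0 \<partial>(lborel :: real measure))"
        using False by (intro nn_integral_cong) (auto simp: \<rho>_def indicator_def)
      finally show ?thesis using False by simp
    qed
    then show "emeasure (distr lborel borel (\<lambda>z::'a. - (norm z)\<^sup>2)) {x<..} = emeasure (density lborel \<rho>) {x<..}"
      unfolding eq by simp
    show "emeasure (distr lborel borel (\<lambda>z::'a. - (norm z)\<^sup>2)) {x<..} < \<infinity>"
      unfolding eq by simp
  qed auto
  then have "(\<integral>\<^sup>+v. \<phi> (- v) \<partial>distr lborel borel (\<lambda>z::'a. - (norm z)\<^sup>2)) = (\<integral>\<^sup>+v. \<phi> (- v) \<partial>density lborel \<rho>)"
    by simp
  also have "(\<integral>\<^sup>+v. \<phi> (- v) \<partial>density lborel \<rho>) = (\<integral>\<^sup>+v. \<rho> v * \<phi> (- v) \<partial>lborel)"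
    using \<rho>_meas \<phi> by (intro nn_integral_density) auto
  also have "\<dots> = (\<integral>\<^sup>+u. \<rho> (0 + (- 1) * u) * \<phi> (- (0 + (- 1) * u)) \<partial>lborel)"
    using \<rho>_meas \<phi> by (subst nn_integral_real_affine[where c = "- 1" and t = 0]) auto
  also have "\<dots> = (\<integral>\<^sup>+u. \<phi> u * ennreal (indicator {0..} u * (n / 2 * unit_ball_vol n * u powr (n / 2 - 1))) \<partial>lborel)"
    by (intro nn_integral_cong) (auto simp: \<rho>_def indicator_def mult.commute)
  finally show ?thesis using \<phi> by (subst (asm) nn_integral_distr) auto
qed

text \<open>The radial density contributes \<open>n / 2 - 1\<close> to the exponent of the squared
  norm, and the power of the norm contributes \<open>p / 2\<close>; together they form the Gamma
  integral at \<open>(n + p) / 2\<close>. The case \<open>p = 0\<close> is included for the plain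
  Gaussian integral on the line.\<close>

lemma nn_integral_gauss_norm_powr:
  assumes p: "0 \<le> p"
  defines "n \<equiv> real DIM('a::euclidean_space)"
  shows "(\<integral>\<^sup>+(z::'a). ennreal (norm z powr p * exp (- (norm z)\<^sup>2)) \<partial>lborel) =
    ennreal (pi powr (n / 2) * Gamma ((n + p) / 2) / Gamma (n / 2))"
proof -
  have n: "0 < n" by (simp add: n_def)
  define c where "c = n / 2 * unit_ball_vol n"
  \<comment> \<open>The ball volume is \<open>pi powr (n / 2) / Gamma (n / 2 + 1)\<close>, and the
    factor \<open>n / 2\<close> is absorbed by the recursion of the Gamma function.\<close>
  have c: "c = pi powr (n / 2) / Gamma (n / 2)"
    using n Gamma_plus1[of "n / 2"] by (simp add: c_def unit_ball_vol_def nonpos_Ints_def field_simps)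
  have c0: "0 \<le> c" using n unfolding c by (simp add: Gamma_real_nonneg)
  have norm_eq: "norm z powr p = ((norm z)\<^sup>2) powr (p / 2)" for z :: 'a
    by (cases "z = 0") (simp_all add: powr_powr powr_realpow[symmetric] flip: powr_numeral)
  have "(\<integral>\<^sup>+(z::'a). ennreal (norm z powr p * exp (- (norm z)\<^sup>2)) \<partial>lborel) =
      (\<integral>\<^sup>+(z::'a). (\<lambda>u. ennreal (u powr (p / 2) * exp (- u))) ((norm z)\<^sup>2) \<partial>lborel)"
    by (simp add: norm_eq)
  also have "\<dots> = (\<integral>\<^sup>+u. ennreal (u powr (p / 2) * exp (- u)) *
      ennreal (indicator {0..} u * (c * u powr (n / 2 - 1))) \<partial>lborel)"
    unfolding c_def n_def by (rule nn_integral_radial) measurable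
  also have "\<dots> = (\<integral>\<^sup>+u. ennreal (indicator {0..} u * (c * (u powr ((n + p) / 2 - 1) / exp u))) \<partial>lborel)"
  proof (intro nn_integral_cong)
    fix u :: real
    have "u powr (p / 2) * exp (- u) * (c * u powr (n / 2 - 1)) = c * (u powr ((n + p) / 2 - 1) / exp u)"
    proof -
      have "u powr ((n + p) / 2 - 1) = u powr (p / 2) * u powr (n / 2 - 1)"
        by (simp add: powr_add[symmetric] field_simps)
      then show ?thesis by (simp add: exp_minus field_simps)
    qed
    then show "ennreal (u powr (p / 2) * exp (- u)) * ennreal (indicator {0..} u * (c * u powr (n / 2 - 1))) =
        ennreal (indicator {0..} u * (c * (u powr ((n + p) / 2 - 1) / exp u)))"
      using c0 by (auto simp: indicator_def ennreal_mult[symmetric])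
  qed
  also have "\<dots> = ennreal (c * Gamma ((n + p) / 2))"
  proof (rule nn_integral_has_integral_lebesgue)
    show "((\<lambda>u. c * (u powr ((n + p) / 2 - 1) / exp u)) has_integral c * Gamma ((n + p) / 2)) {0..}"
      using n p by (intro has_integral_mult_right Gamma_integral_real) auto
  qed (use c0 in auto)
  finally show ?thesis by (simp add: c)
qed

text \<open>In coordinates the integrand is a product: the coordinate along \<open>e\<close> yields
  the Gaussian moment of order \<open>p\<close> on the line, and each of the others yields
  \<open>sqrt pi\<close>. Both factors are instances of the preceding radial formula in dimension
  one.\<close>

lemma nn_integral_gauss_inner_Basis_powr:
  fixes e :: "'a::euclidean_space"
  assumes p: "0 < p" and e: "e \<in> Basis"
  shows "(\<integral>\<^sup>+z. ennreal (\<bar>e \<bullet> z\<bar> powr p * exp (- (norm z)\<^sup>2)) \<partial>lborel) =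
    ennreal (Gamma ((1 + p) / 2) * sqrt pi ^ (DIM('a) - 1))"
proof -
  have one: "(\<integral>\<^sup>+(s::real). ennreal (\<bar>s\<bar> powr q * exp (- s\<^sup>2)) \<partial>lborel) = ennreal (Gamma ((1 + q) / 2))"
    if "0 \<le> q" for q
    using nn_integral_gauss_norm_powr[OF that, where 'a = real]
    by (simp add: Gamma_one_half_real powr_half_sqrt)
  have zero: "(\<integral>\<^sup>+(s::real). ennreal (exp (- s\<^sup>2)) \<partial>lborel) = ennreal (sqrt pi)"
  proof -
    \<comment> \<open>As \<open>0 powr 0 = 0\<close>, the two integrands differ at
      \<open>s = 0\<close>, hence only on a null set.\<close>
    have "(\<integral>\<^sup>+(s::real). ennreal (exp (- s\<^sup>2)) \<partial>lborel) = (\<integral>\<^sup>+(s::real). ennreal (\<bar>s\<bar> powr 0 * exp (- s\<^sup>2)) \<partial>lborel)"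
      by (rule nn_integral_cong_AE, use AE_lborel_singleton[of 0] in eventually_elim) auto
    also have "\<dots> = ennreal (sqrt pi)" using one[of 0] by (simp add: Gamma_one_half_real)
    finally show ?thesis .
  qed
  define f where "f b s = ennreal ((if b = e then \<bar>s\<bar> powr p else 1) * exp (- s\<^sup>2))" for b :: 'a and s :: real
  interpret product_sigma_finite "\<lambda>_ :: 'a. lborel :: real measure" ..
  have "(\<integral>\<^sup>+z. ennreal (\<bar>e \<bullet> z\<bar> powr p * exp (- (norm z)\<^sup>2)) \<partial>lborel) =
      (\<integral>\<^sup>+g. ennreal (\<bar>e \<bullet> (\<Sum>b\<in>Basis. g b *\<^sub>R b)\<bar> powr p * exp (- (norm (\<Sum>b\<in>Basis. g b *\<^sub>R b))\<^sup>2))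
        \<partial>(\<Pi>\<^sub>M b\<in>Basis. lborel))"
    unfolding lborel_eq[where 'a = 'a] by (rule nn_integral_distr) measurable
  also have "\<dots> = (\<integral>\<^sup>+g. (\<Prod>b\<in>Basis. f b (g b)) \<partial>(\<Pi>\<^sub>M b\<in>Basis. lborel))"
  proof (intro nn_integral_cong)
    fix g :: "'a \<Rightarrow> real"
    let ?z = "\<Sum>b\<in>Basis. g b *\<^sub>R b"
    have "(norm ?z)\<^sup>2 = (\<Sum>b\<in>Basis. (g b)\<^sup>2)"
      by (subst power2_norm_eq_inner, subst euclidean_inner) (simp add: power2_eq_square)
    then have "exp (- (norm ?z)\<^sup>2) = (\<Prod>b\<in>Basis. exp (- (g b)\<^sup>2))"
      by (simp add: sum_negf[symmetric] exp_sum)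
    moreover have "e \<bullet> ?z = g e"
      using e by (simp add: inner_commute[of e] inner_sum_left_Basis)
    moreover have "(\<Prod>b\<in>Basis. if b = e then \<bar>g b\<bar> powr p else 1) = \<bar>g e\<bar> powr p"
      using e by (simp add: prod.delta)
    ultimately have "\<bar>e \<bullet> ?z\<bar> powr p * exp (- (norm ?z)\<^sup>2) =
        (\<Prod>b\<in>Basis. (if b = e then \<bar>g b\<bar> powr p else 1) * exp (- (g b)\<^sup>2))"
      by (simp add: prod.distrib)
    also have "ennreal \<dots> = (\<Prod>b\<in>Basis. f b (g b))"
      unfolding f_def by (intro prod_ennreal[symmetric]) auto
    finally show "ennreal (\<bar>e \<bullet> ?z\<bar> powr p * exp (- (norm ?z)\<^sup>2)) = (\<Prod>b\<in>Basis. f b (g b))" .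
  qed
  also have "\<dots> = (\<Prod>b\<in>Basis. \<integral>\<^sup>+s. f b s \<partial>lborel)"
    by (intro product_nn_integral_prod) (auto simp: f_def)
  also have "\<dots> = (\<integral>\<^sup>+s. f e s \<partial>lborel) * (\<Prod>b\<in>Basis - {e}. \<integral>\<^sup>+s. f b s \<partial>lborel)"
    using e by (intro prod.remove) auto
  also have "(\<Prod>b\<in>Basis - {e}. \<integral>\<^sup>+s. f b s \<partial>lborel) = (\<Prod>b\<in>Basis - {e}. ennreal (sqrt pi))"
    by (intro prod.cong refl) (auto simp: f_def zero)
  also have "(\<integral>\<^sup>+s. f e s \<partial>lborel) = ennreal (Gamma ((1 + p) / 2))"
    using one[of p] p by (simp add: f_def)
  also have "(\<Prod>b\<in>Basis - {e}. ennreal (sqrt pi)) = ennreal (sqrt pi ^ (DIM('a) - 1))"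
    using e by (simp add: ennreal_power card_Diff_singleton)
  finally show ?thesis
    using p by (simp add: ennreal_mult Gamma_real_nonneg)
qed

section \<open>Rotation invariance and the spherical average\<close>

lemma rotation_invariant_prob_measurable:
  assumes "rotation_invariant_prob L"
  shows "(\<lambda>t. t) \<in> borel_measurable L" and "space L = sphere 0 1"
proof -
  have L: "sets L = sets (restrict_space borel (sphere 0 1))"
    using assms by (simp add: rotation_invariant_prob_def)
  then show "space L = sphere 0 1"
    by (auto dest: sets_eq_imp_space_eq simp: space_restrict_space)
  have "(\<lambda>t :: 'a. t) \<in> borel_measurable (restrict_space borel (sphere 0 1))"
    by (intro measurable_restrict_space1) simp
  then show "(\<lambda>t. t) \<in> borel_measurable L" using measurable_cong_sets[OF L refl] by blast
qed

lemma orthogonal_transformation_borel_measurable: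
  fixes f :: "'a::euclidean_space \<Rightarrow> 'a"
  assumes "orthogonal_transformation f"
  shows "f \<in> borel_measurable borel"
  using orthogonal_transformation_linear[OF assms]
  by (intro borel_measurable_continuous_onI linear_continuous_on) (simp add: linear_conv_bounded_linear)

text \<open>An orthogonal \<open>f\<close> with \<open>f (norm x *\<^sub>R e) = x\<close> gives
  \<open>x \<bullet> f z = norm x * (e \<bullet> z)\<close>, and invariance allows \<open>z\<close>
  to be replaced by \<open>f z\<close>. The radial weight \<open>w\<close> lets the lemma serve both
  the sphere (weight 1) and Lebesgue measure (Gaussian weight).\<close>

lemma nn_integral_invariant_inner_powr:
  fixes R :: "(real ^ 'n) measure" and w :: "real \<Rightarrow> real"
  assumes meas: "(\<lambda>z. z) \<in> borel_measurable R"
    and inv: "\<And>f h. orthogonal_transformation f \<Longrightarrow> h \<in> borel_measurable borel \<Longrightarrow>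
      (\<integral>\<^sup>+z. h (f z) \<partial>R) = (\<integral>\<^sup>+z. h z \<partial>R)"
    and w: "w \<in> borel_measurable borel" "\<And>r. 0 \<le> w r" and e: "norm e = 1"
  shows "(\<integral>\<^sup>+z. ennreal (\<bar>x \<bullet> z\<bar> powr p * w (norm z)) \<partial>R) =
    ennreal (norm x powr p) * (\<integral>\<^sup>+z. ennreal (\<bar>e \<bullet> z\<bar> powr p * w (norm z)) \<partial>R)"
proof -
  obtain f where f: "orthogonal_transformation f" "f (norm x *\<^sub>R e) = x"
    using orthogonal_transformation_exists[of "norm x *\<^sub>R e" x] e by auto
  note w(1)[measurable] meas[measurable]
  have "(\<integral>\<^sup>+z. ennreal (\<bar>x \<bullet> z\<bar> powr p * w (norm z)) \<partial>R) =
      (\<integral>\<^sup>+z. ennreal (\<bar>x \<bullet> f z\<bar> powr p * w (norm (f z))) \<partial>R)"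
    by (rule inv[OF f(1), symmetric]) measurable
  also have "\<dots> = (\<integral>\<^sup>+z. ennreal (norm x powr p) * ennreal (\<bar>e \<bullet> z\<bar> powr p * w (norm z)) \<partial>R)"
  proof (intro nn_integral_cong)
    fix z
    have "x \<bullet> f z = norm x * (e \<bullet> z)"
      using f unfolding orthogonal_transformation_def by (metis inner_scaleR_left)
    then show "ennreal (\<bar>x \<bullet> f z\<bar> powr p * w (norm (f z))) =
        ennreal (norm x powr p) * ennreal (\<bar>e \<bullet> z\<bar> powr p * w (norm z))"
      using w(2) by (simp add: orthogonal_transformation_norm[OF f(1)] abs_mult powr_mult
          ennreal_mult[symmetric] mult.assoc)
  qed
  also have "\<dots> = ennreal (norm x powr p) * (\<integral>\<^sup>+z. ennreal (\<bar>e \<bullet> z\<bar> powr p * w (norm z)) \<partial>R)"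
    by (rule nn_integral_cmult) measurable
  finally show ?thesis .
qed

text \<open>By invariance the average is \<open>norm x powr p\<close> times its value
  \<open>c\<close> at a unit vector. To find \<open>c\<close>, |<t, z>|^p exp(-|z|^2) is integrated
  over \<open>t\<close> in the sphere and \<open>z\<close> in the whole space in both orders.
  Integrating in \<open>z\<close> first gives the same coordinate moment for every unit vector
  \<open>t\<close>; integrating in \<open>t\<close> first gives \<open>c\<close> times the radial
  moment.\<close>

lemma norm_powr_eq_spherical_average:
  fixes L :: "(real ^ 'n) measure"
  assumes L: "rotation_invariant_prob L" and p: "0 < p"
  shows "norm x powr p = b_const p CARD('n) * (LINT t|L. \<bar>x \<bullet> t\<bar> powr p)"
proof -
  interpret L: prob_space L using L by (simp add: rotation_invariant_prob_def)
  note idL[measurable] = rotation_invariant_prob_measurable(1)[OF L]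
  note spL = rotation_invariant_prob_measurable(2)[OF L]
  have setsL: "sets L = sets (restrict_space borel (sphere 0 1))"
    using L by (simp add: rotation_invariant_prob_def)
  define n where "n = real CARD('n)"
  have n: "0 < n" by (simp add: n_def)
  obtain e :: "real ^ 'n" where e: "e \<in> Basis" using nonempty_Basis by blast
  have ne: "norm e = 1" using e by simp
  \<comment> \<open>Working with extended nonnegative values permits the exchange of integrals by
    Tonelli before \<open>g e\<close> is known to be finite.\<close>
  define g where "g x = (\<integral>\<^sup>+t. ennreal (\<bar>x \<bullet> t\<bar> powr p) \<partial>L)" for x
  have g: "g x = ennreal (norm x powr p) * g e" for x
  proof -
    have inv: "(\<integral>\<^sup>+z. h (f z) \<partial>L) = (\<integral>\<^sup>+z. h z \<partial>L)"
      if f: "orthogonal_transformation f" and h: "h \<in> borel_measurable borel" for f :: "real ^ 'n \<Rightarrow> real ^ 'n" and h :: "real ^ 'n \<Rightarrow> ennreal"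
    proof -
      have "f \<in> borel_measurable L"
        using measurable_compose[OF idL orthogonal_transformation_borel_measurable[OF f]] by simp
      then have "f \<in> measurable L (restrict_space borel (sphere 0 1))"
        by (intro measurable_restrict_space2) (auto simp: spL orthogonal_transformation_norm[OF f])
      then have fL: "f \<in> measurable L L" using measurable_cong_sets[OF refl setsL] by blast
      have hL: "h \<in> borel_measurable L" using measurable_compose[OF idL h] by simp
      have "(\<integral>\<^sup>+z. h z \<partial>distr L L f) = (\<integral>\<^sup>+z. h (f z) \<partial>L)"
        using fL hL by (intro nn_integral_distr) auto
      moreover have "distr L L f = L" using L f by (simp add: rotation_invariant_prob_def)
      ultimately show ?thesis by simp
    qed
    have "(\<integral>\<^sup>+z. ennreal (\<bar>x \<bullet> z\<bar> powr p * 1) \<partial>L) =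
        ennreal (norm x powr p) * (\<integral>\<^sup>+z. ennreal (\<bar>e \<bullet> z\<bar> powr p * 1) \<partial>L)"
    proof (rule nn_integral_invariant_inner_powr[where w = "\<lambda>_. 1"])
      show "(\<integral>\<^sup>+z. h (f z) \<partial>L) = (\<integral>\<^sup>+z. h z \<partial>L)"
        if "orthogonal_transformation f" "h \<in> borel_measurable borel" for f h
        using that by (rule inv)
    qed (simp_all add: idL ne)
    then show ?thesis by (simp add: g_def)
  qed
  have G: "(\<integral>\<^sup>+z. ennreal (\<bar>t \<bullet> z\<bar> powr p * exp (- (norm z)\<^sup>2)) \<partial>lborel) =
      ennreal (Gamma ((1 + p) / 2) * sqrt pi ^ (CARD('n) - 1))" if "norm t = 1" for t :: "real ^ 'n"
  proof -
    have inv: "(\<integral>\<^sup>+z. h (f z) \<partial>lborel) = (\<integral>\<^sup>+z. h z \<partial>lborel)"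
      if f: "orthogonal_transformation f" and h: "h \<in> borel_measurable borel" for f :: "real ^ 'n \<Rightarrow> real ^ 'n" and h :: "real ^ 'n \<Rightarrow> ennreal"
      using nn_integral_distr[of f lborel borel h] orthogonal_transformation_borel_measurable[OF f] h
      by (simp add: distr_lborel_orthogonal[OF f])
    have "(\<integral>\<^sup>+z. ennreal (\<bar>t \<bullet> z\<bar> powr p * exp (- (norm z)\<^sup>2)) \<partial>lborel) =
        ennreal (norm t powr p) * (\<integral>\<^sup>+z. ennreal (\<bar>e \<bullet> z\<bar> powr p * exp (- (norm z)\<^sup>2)) \<partial>lborel)"
    proof (rule nn_integral_invariant_inner_powr[where w = "\<lambda>r. exp (- r\<^sup>2)"])
      show "(\<integral>\<^sup>+z. h (f z) \<partial>lborel) = (\<integral>\<^sup>+z. h z \<partial>lborel)"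
        if "orthogonal_transformation f" "h \<in> borel_measurable borel" for f :: "real ^ 'n \<Rightarrow> real ^ 'n" and h :: "real ^ 'n \<Rightarrow> ennreal"
        using that by (rule inv)
    qed (simp_all add: ne)
    then show ?thesis using that nn_integral_gauss_inner_Basis_powr[OF p e] ne by simp
  qed
  interpret pair_sigma_finite L "lborel :: (real ^ 'n) measure" ..
  have "ennreal (Gamma ((1 + p) / 2) * sqrt pi ^ (CARD('n) - 1)) =
      (\<integral>\<^sup>+t. ennreal (Gamma ((1 + p) / 2) * sqrt pi ^ (CARD('n) - 1)) \<partial>L)"
    by (simp add: L.emeasure_space_1)
  also have "\<dots> = (\<integral>\<^sup>+t. \<integral>\<^sup>+z. ennreal (\<bar>t \<bullet> z\<bar> powr p * exp (- (norm z)\<^sup>2)) \<partial>lborel \<partial>L)"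
    by (intro nn_integral_cong) (simp add: G spL)
  also have "\<dots> = (\<integral>\<^sup>+z. \<integral>\<^sup>+t. ennreal (\<bar>t \<bullet> z\<bar> powr p * exp (- (norm z)\<^sup>2)) \<partial>L \<partial>lborel)"
    by (rule Fubini'[symmetric]) measurable
  also have "\<dots> = (\<integral>\<^sup>+(z::real ^ 'n). ennreal (norm z powr p * exp (- (norm z)\<^sup>2)) * g e \<partial>lborel)"
  proof (rule nn_integral_cong)
    fix z :: "real ^ 'n"
    have "(\<integral>\<^sup>+t. ennreal (\<bar>t \<bullet> z\<bar> powr p * exp (- (norm z)\<^sup>2)) \<partial>L) = g z * ennreal (exp (- (norm z)\<^sup>2))"
      unfolding g_def inner_commute[of z] by (simp add: ennreal_mult nn_integral_multc)
    also have "\<dots> = ennreal (norm z powr p * exp (- (norm z)\<^sup>2)) * g e"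
      by (subst g) (simp add: ennreal_mult ac_simps)
    finally show "(\<integral>\<^sup>+t. ennreal (\<bar>t \<bullet> z\<bar> powr p * exp (- (norm z)\<^sup>2)) \<partial>L) =
        ennreal (norm z powr p * exp (- (norm z)\<^sup>2)) * g e" .
  qed
  also have "\<dots> = ennreal (pi powr (n / 2) * Gamma ((n + p) / 2) / Gamma (n / 2)) * g e"
    using nn_integral_gauss_norm_powr[of p, where 'a = "real ^ 'n"] p
    by (simp add: nn_integral_multc n_def)
  finally have key: "ennreal (Gamma ((1 + p) / 2) * sqrt pi ^ (CARD('n) - 1)) =
      ennreal (pi powr (n / 2) * Gamma ((n + p) / 2) / Gamma (n / 2)) * g e" .
  define c where "c = (LINT t|L. \<bar>e \<bullet> t\<bar> powr p)"
  have int: "(LINT t|L. \<bar>x \<bullet> t\<bar> powr p) = enn2real (g x)" for x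
    unfolding g_def by (rule integral_eq_nn_integral) auto
  \<comment> \<open>Finiteness of \<open>g e\<close>, without which \<open>enn2real\<close> would
    lose its value; on the sphere the integrand is at most 1.\<close>
  have "g e \<le> (\<integral>\<^sup>+t. 1 \<partial>L)"
    unfolding g_def
  proof (intro nn_integral_mono)
    fix t assume "t \<in> space L"
    then have "\<bar>e \<bullet> t\<bar> \<le> 1" using Cauchy_Schwarz_ineq2[of e t] ne by (simp add: spL)
    then show "ennreal (\<bar>e \<bullet> t\<bar> powr p) \<le> 1"
      using p by (simp add: powr_le1)
  qed
  then have "g e < \<top>" by (simp add: L.emeasure_space_1 le_less_trans)
  then have ge: "g e = ennreal c" unfolding c_def int by simp
  have c0: "0 \<le> c" by (simp add: c_def)
  have pos: "0 < Gamma ((n + p) / 2)" "0 < Gamma (n / 2)" "0 < Gamma ((1 + p) / 2)"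
    using n p by (auto intro: Gamma_real_pos)
  have "Gamma ((1 + p) / 2) * sqrt pi ^ (CARD('n) - 1) =
      pi powr (n / 2) * Gamma ((n + p) / 2) / Gamma (n / 2) * c"
    using key pos c0 unfolding ge by (simp add: ennreal_mult[symmetric])
  moreover have "pi powr (n / 2) = sqrt pi * sqrt pi ^ (CARD('n) - 1)"
  proof -
    have "pi powr (n / 2) = sqrt pi powr n" by (simp add: powr_half_sqrt[symmetric] powr_powr)
    also have "\<dots> = sqrt pi ^ CARD('n)" by (simp add: n_def powr_realpow)
    also have "\<dots> = sqrt pi * sqrt pi ^ (CARD('n) - 1)" by (simp add: power_eq_if)
    finally show ?thesis .
  qed
  ultimately have "Gamma ((1 + p) / 2) * sqrt pi ^ (CARD('n) - 1) =
      (sqrt pi * Gamma ((n + p) / 2) / Gamma (n / 2) * c) * sqrt pi ^ (CARD('n) - 1)"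
    by simp
  moreover have "sqrt pi ^ (CARD('n) - 1) \<noteq> 0" by simp
  ultimately have eq: "Gamma ((1 + p) / 2) = sqrt pi * Gamma ((n + p) / 2) / Gamma (n / 2) * c"
    using mult_right_cancel by blast
  then have "c \<noteq> 0" using pos by auto
  with eq have "b_const p CARD('n) * c = 1"
    using pos unfolding b_const_def n_def[symmetric] by (simp add: field_simps add.commute[of p])
  moreover have "(LINT t|L. \<bar>x \<bullet> t\<bar> powr p) = norm x powr p * c"
    unfolding int by (subst g) (simp add: ge enn2real_mult c0)
  ultimately show ?thesis by simp
qed

section \<open>The dual norm\<close>

text \<open>Homogeneity and the triangle inequality make \<open>N\<close> convex, and a real convex
  function on an open subset of a Euclidean space is continuous.\<close>

lemma is_norm_continuous:
  fixes N :: "'a::euclidean_space \<Rightarrow> real"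
  assumes N: "is_norm N"
  shows "continuous_on UNIV N"
proof (rule convex_on_continuous[OF open_UNIV], rule convex_onI)
  fix t :: real and x y :: 'a assume t: "0 < t" "t < 1"
  have "N ((1 - t) *\<^sub>R x + t *\<^sub>R y) \<le> N ((1 - t) *\<^sub>R x) + N (t *\<^sub>R y)"
    using N unfolding is_norm_def by blast
  also have "\<dots> = (1 - t) * N x + t * N y"
    using N t unfolding is_norm_def by simp
  finally show "N ((1 - t) *\<^sub>R x + t *\<^sub>R y) \<le> (1 - t) * N x + t * N y" .
qed simp

text \<open>By compactness \<open>N\<close> attains a positive minimum on the Euclidean unit sphere;
  by homogeneity its reciprocal bounds the Euclidean norm on the unit ball.\<close>

lemma bounded_unit_ball:
  fixes N :: "'a::euclidean_space \<Rightarrow> real"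
  assumes N: "is_norm N"
  shows "bounded (unit_ball N)"
proof -
  have "compact (sphere (0 :: 'a) 1)" "sphere (0 :: 'a) 1 \<noteq> {}" by auto
  then obtain x0 :: 'a where x0: "norm x0 = 1" "\<And>x. norm x = 1 \<Longrightarrow> N x0 \<le> N x"
    using continuous_attains_inf[of "sphere 0 1" N] continuous_on_subset[OF is_norm_continuous[OF N]]
    by auto
  have "x0 \<noteq> 0" using x0(1) by auto
  then have pos: "0 < N x0" using N unfolding is_norm_def by (metis less_le)
  have "norm x \<le> 1 / N x0" if "N x \<le> 1" for x
  proof (cases "x = 0")
    case False
    have "N x0 \<le> N ((1 / norm x) *\<^sub>R x)" using False by (intro x0(2)) simp
    also have "\<dots> = N x / norm x" using N unfolding is_norm_def by simp
    also have "\<dots> \<le> 1 / norm x" using that by (intro divide_right_mono) auto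
    finally show ?thesis using pos False by (simp add: field_simps)
  qed (use pos in simp)
  then show ?thesis unfolding unit_ball_def bounded_iff by auto
qed

context
  fixes N :: "'a::euclidean_space \<Rightarrow> real" and R :: real
  assumes N: "is_norm N" and R: "\<And>x. x \<in> unit_ball N \<Longrightarrow> norm x \<le> R"
begin

lemma abs_inner_unit_ball_le: "x \<in> unit_ball N \<Longrightarrow> \<bar>x \<bullet> t\<bar> \<le> R * norm t"
  using Cauchy_Schwarz_ineq2[of x t] mult_right_mono[OF R, of x "norm t"] by auto

lemma zero_in_unit_ball: "0 \<in> unit_ball N"
proof -
  have "N 0 = 0" using N by (simp add: is_norm_def)
  then show ?thesis by (simp add: unit_ball_def)
qed

lemma abs_inner_le_dual_norm: "x \<in> unit_ball N \<Longrightarrow> \<bar>x \<bullet> t\<bar> \<le> dual_norm N t"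
  unfolding dual_norm_def using abs_inner_unit_ball_le
  by (intro cSUP_upper bdd_aboveI2) auto

text \<open>Tested on the vector \<open>t / N t\<close> of the unit ball. Positivity makes division
  by the dual norm legitimate in the projection to the interval.\<close>

lemma dual_norm_pos:
  assumes "t \<noteq> 0"
  shows "0 < dual_norm N t"
proof -
  have pos: "0 < N t" using N assms unfolding is_norm_def by (metis less_le)
  then have "(1 / N t) *\<^sub>R t \<in> unit_ball N"
    using N unfolding is_norm_def unit_ball_def by simp
  then have "\<bar>((1 / N t) *\<^sub>R t) \<bullet> t\<bar> \<le> dual_norm N t" by (rule abs_inner_le_dual_norm)
  moreover have "0 < \<bar>((1 / N t) *\<^sub>R t) \<bullet> t\<bar>" using pos assms by simp
  ultimately show ?thesis by linarith
qed

lemma dual_norm_le: "dual_norm N t \<le> R * norm t"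
  unfolding dual_norm_def using zero_in_unit_ball abs_inner_unit_ball_le
  by (intro cSUP_least) auto

text \<open>The Euclidean bound \<open>R\<close> on the unit ball is a Lipschitz constant for a
  supremum of functionals given by its points. Continuity is what makes the dual norm measurable on
  the sphere.\<close>

lemma continuous_dual_norm: "continuous_on UNIV (dual_norm N)"
proof -
  have le: "dual_norm N s \<le> dual_norm N t + R * norm (s - t)" for s t
    unfolding dual_norm_def[of N s]
  proof (rule cSUP_least)
    fix x assume x: "x \<in> unit_ball N"
    have "\<bar>x \<bullet> s\<bar> \<le> \<bar>x \<bullet> t\<bar> + \<bar>x \<bullet> (s - t)\<bar>" by (simp add: inner_diff_right)
    also have "\<dots> \<le> dual_norm N t + R * norm (s - t)"
      using abs_inner_le_dual_norm[OF x] abs_inner_unit_ball_le[OF x] by (rule add_mono)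
    finally show "\<bar>x \<bullet> s\<bar> \<le> dual_norm N t + R * norm (s - t)" .
  qed (use zero_in_unit_ball in auto)
  have "0 \<le> R" using R[OF zero_in_unit_ball] by simp
  then have "R-lipschitz_on UNIV (dual_norm N)"
  proof (intro lipschitz_onI)
    show "dist (dual_norm N s) (dual_norm N t) \<le> R * dist s t" for s t
      using le[of s t] le[of t s] by (simp add: dist_norm norm_minus_commute[of t s] abs_le_iff)
  qed
  then show ?thesis by (rule lipschitz_on_continuous_on)
qed

end

section \<open>Projection to an interval\<close>

lemma diff_energy_cmult: "diff_energy P Q (\<lambda>x y. c * k x y) = c * diff_energy P Q k"
  unfolding diff_energy_def by (simp add: right_diff_distrib)

text \<open>The two measures are pushed forward separately, and total mass 1 is kept because
  \<open>g\<close> maps the whole space into \<open>K\<close>. The images may overlap even if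
  \<open>P\<close> and \<open>Q\<close> are Jordan parts, so the energy of their difference is
  evaluated through this very pair by \<open>energy_eq_diff_energy\<close>.\<close>

lemma diff_energy_pushforward_le:
  fixes K :: "'b::{metric_space, second_countable_topology} set"
  assumes P: "finite_measure P" "sets P = sets M" and Q: "finite_measure Q" "sets Q = sets M"
    and one: "measure P (space M) - measure Q (space M) = 1"
    and g: "g \<in> borel_measurable M" and gK: "\<And>x. x \<in> space M \<Longrightarrow> g x \<in> K"
    and K: "bounded K" and p: "0 < p"
  shows "ereal (diff_energy P Q (\<lambda>x y. dist (g x) (g y) powr p)) \<le> max_energy p K"
proof -
  let ?K = "restrict_space borel K"
  let ?P = "distr P ?K g" and ?Q = "distr Q ?K g"
  have gM: "g \<in> measurable M ?K" using g gK by (intro measurable_restrict_space2) auto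
  have sp: "space R = space M" and gR: "g \<in> measurable R ?K" if "sets R = sets M" for R
    using gM sets_eq_imp_space_eq[OF that] by (auto simp: measurable_cong_sets[OF that refl])
  have fin: "finite_measure ?P" "finite_measure ?Q"
    using finite_measure.finite_measure_distr[OF P(1) gR[OF P(2)]]
      finite_measure.finite_measure_distr[OF Q(1) gR[OF Q(2)]] by auto
  define \<nu> where "\<nu> A = measure ?P A - measure ?Q A" for A
  have sm: "signed_measure ?K \<nu>"
    unfolding \<nu>_def by (rule signed_measure_diff) (simp_all add: fin)
  have spK: "space ?K = K" by (simp add: space_restrict_space)
  have KK: "K \<in> sets ?K" using sets.top[of ?K] spK by simp
  have pre: "g -` K \<inter> space M = space M" using gK by auto
  have "\<nu> K = 1"
    unfolding \<nu>_def using one KK pre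
    by (simp add: measure_distr[OF gR[OF P(2)]] measure_distr[OF gR[OF Q(2)]] sp[OF P(2)] sp[OF Q(2)])
  then have "\<nu> \<in> signed_prob K" using sm by (simp add: signed_prob_def)
  moreover have "energy p K \<nu> = diff_energy P Q (\<lambda>x y. dist (g x) (g y) powr p)"
  proof -
    let ?k = "\<lambda>x y :: 'b. dist x y powr p"
    note km = borel_measurable_dist_powr(1)[of p K] and kmy = borel_measurable_dist_powr(2)[of _ p K]
    have "(LINT y|distr A ?K g. LINT x|distr B ?K g. ?k x y) = (LINT y|A. LINT x|B. ?k (g x) (g y))"
      if A: "sets A = sets M" and B: "finite_measure B" "sets B = sets M" for A B
    proof -
      have "(\<lambda>y. LINT x|distr B ?K g. ?k x y) \<in> borel_measurable ?K"
        using finite_measure.finite_measure_distr[OF B(1) gR[OF B(2)]] km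
        by (intro borel_measurable_integral_kernel) (simp_all cong: measurable_cong_sets)
      then have "(LINT y|distr A ?K g. LINT x|distr B ?K g. ?k x y) = (LINT y|A. LINT x|distr B ?K g. ?k x (g y))"
        by (rule integral_distr[OF gR[OF A]])
      also have "\<dots> = (LINT y|A. LINT x|B. ?k (g x) (g y))"
        by (simp add: integral_distr[OF gR[OF B(2)] kmy])
      finally show ?thesis .
    qed
    then have "diff_energy ?P ?Q ?k = diff_energy P Q (\<lambda>x y. ?k (g x) (g y))"
      unfolding diff_energy_def using P Q by simp
    moreover have "energy p K \<nu> = diff_energy ?P ?Q ?k"
      by (rule energy_eq_diff_energy[OF sm K p fin(1) _ fin(2)]) (simp_all add: \<nu>_def)
    ultimately show ?thesis by simp
  qed
  ultimately show ?thesis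
    unfolding max_energy_def by (metis SUP_upper)
qed

text \<open>Fubini in each of the four iterated integrals. The integrability is recorded for the
  later comparison of integrals over \<open>t\<close>.\<close>

lemma diff_energy_average:
  fixes k :: "'a \<Rightarrow> 'a \<Rightarrow> 'c \<Rightarrow> real"
  assumes P: "finite_measure P" "sets P = sets M" and Q: "finite_measure Q" "sets Q = sets M"
    and L: "finite_measure L"
    and k: "(\<lambda>((y, x), t). k x y t) \<in> borel_measurable ((M \<Otimes>\<^sub>M M) \<Otimes>\<^sub>M L)"
    and c: "\<And>x y t. x \<in> space M \<Longrightarrow> y \<in> space M \<Longrightarrow> t \<in> space L \<Longrightarrow> \<bar>k x y t\<bar> \<le> c"
  shows "diff_energy P Q (\<lambda>x y. LINT t|L. k x y t) = (LINT t|L. diff_energy P Q (\<lambda>x y. k x y t))"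
    and "integrable L (\<lambda>t. diff_energy P Q (\<lambda>x y. k x y t))"
proof -
  have *: "(LINT y|A. LINT x|B. LINT t|L. k x y t) = (LINT t|L. LINT y|A. LINT x|B. k x y t)"
    "integrable L (\<lambda>t. LINT y|A. LINT x|B. k x y t)"
    if A: "finite_measure A" "sets A = sets M" and B: "finite_measure B" "sets B = sets M" for A B
  proof -
    have m: "(\<lambda>((y, x), t). k x y t) \<in> borel_measurable ((A \<Otimes>\<^sub>M B) \<Otimes>\<^sub>M L)"
      using k measurable_cong_sets[OF sets_pair_measure_cong[OF sets_pair_measure_cong[OF A(2) B(2)] refl] refl]
      by blast
    have b: "\<bar>k x y t\<bar> \<le> c" if "x \<in> space B" "y \<in> space A" "t \<in> space L" for x y t
      using c that sets_eq_imp_space_eq[OF A(2)] sets_eq_imp_space_eq[OF B(2)] by simp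
    show "(LINT y|A. LINT x|B. LINT t|L. k x y t) = (LINT t|L. LINT y|A. LINT x|B. k x y t)"
      "integrable L (\<lambda>t. LINT y|A. LINT x|B. k x y t)"
      using integral_triple_rotate[OF A(1) B(1) L m b] by auto
  qed
  show "integrable L (\<lambda>t. diff_energy P Q (\<lambda>x y. k x y t))"
    unfolding diff_energy_def using * P Q by (intro Bochner_Integration.integrable_diff) auto
  show "diff_energy P Q (\<lambda>x y. LINT t|L. k x y t) = (LINT t|L. diff_energy P Q (\<lambda>x y. k x y t))"
    unfolding diff_energy_def using * P Q by simp
qed

text \<open>The energy on the interval is kept as a separate real number \<open>E\<close>, since
  \<open>\<mm> p\<close> is an extended real not known to be finite.\<close>

lemma diff_energy_projection_le:
  fixes N :: "'a::euclidean_space \<Rightarrow> real"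
  assumes N: "is_norm N" and p: "0 < p" and t: "t \<noteq> 0"
    and P: "finite_measure P" "sets P = sets (restrict_space borel (unit_ball N))"
    and Q: "finite_measure Q" "sets Q = sets (restrict_space borel (unit_ball N))"
    and one: "measure P (unit_ball N) - measure Q (unit_ball N) = 1"
  shows "\<exists>E. diff_energy P Q (\<lambda>x y. \<bar>(x - y) \<bullet> t\<bar> powr p) = dual_norm N t powr p * E \<and> ereal E \<le> \<mm> p"
proof -
  let ?M = "restrict_space borel (unit_ball N)"
  obtain R where R: "\<And>x. x \<in> unit_ball N \<Longrightarrow> norm x \<le> R"
    using bounded_unit_ball[OF N] by (auto simp: bounded_iff)
  define D where "D = dual_norm N t"
  have D: "0 < D" unfolding D_def by (rule dual_norm_pos[OF N R t])
  define g where "g x = (x \<bullet> t) / D" for x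
  have spM: "space ?M = unit_ball N" by (simp add: space_restrict_space)
  have "(\<lambda>x. x) \<in> measurable ?M borel" by (intro measurable_restrict_space1) simp
  then have gm: "g \<in> borel_measurable ?M"
    unfolding g_def by (intro borel_measurable_divide borel_measurable_inner borel_measurable_const)
  have gK: "g x \<in> {-1..1}" if "x \<in> space ?M" for x
  proof -
    have "\<bar>x \<bullet> t\<bar> \<le> D"
      unfolding D_def using that spM by (intro abs_inner_le_dual_norm[OF N R]) auto
    then show ?thesis using D by (auto simp: g_def abs_le_iff field_simps)
  qed
  have "\<bar>(x - y) \<bullet> t\<bar> powr p = D powr p * dist (g x) (g y) powr p" for x y
  proof -
    have "\<bar>(x - y) \<bullet> t\<bar> = D * dist (g x) (g y)"
      using D by (simp add: g_def dist_real_def inner_diff_left diff_divide_distrib[symmetric])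
    then show ?thesis using D by (simp add: powr_mult)
  qed
  then have "diff_energy P Q (\<lambda>x y. \<bar>(x - y) \<bullet> t\<bar> powr p) =
      D powr p * diff_energy P Q (\<lambda>x y. dist (g x) (g y) powr p)"
    by (simp add: diff_energy_cmult)
  moreover have "ereal (diff_energy P Q (\<lambda>x y. dist (g x) (g y) powr p)) \<le> \<mm> p"
    unfolding \<mm>_def using one gm gK p
    by (intro diff_energy_pushforward_le[OF P Q]) (simp_all add: spM)
  ultimately show ?thesis unfolding D_def by blast
qed

lemma energy_unit_ball_le:
  fixes N :: "real ^ 'n \<Rightarrow> real" and L :: "(real ^ 'n) measure"
  assumes N: "is_norm N" and p: "0 < p" and L: "rotation_invariant_prob L"
    and \<mu>: "\<mu> \<in> signed_prob (unit_ball N)"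
  shows "ereal (energy p (unit_ball N) \<mu>)
    \<le> \<mm> p * ereal (b_const p CARD('n) * (LINT t|L. dual_norm N t powr p))"
proof -
  let ?M = "restrict_space borel (unit_ball N)"
  define P Q where "P = pos_part_measure ?M \<mu>" and "Q = pos_part_measure ?M (\<lambda>A. - \<mu> A)"
  let ?k = "\<lambda>x y t. \<bar>(x - y) \<bullet> t\<bar> powr p" and ?b = "b_const p CARD('n)"
  interpret L: prob_space L using L by (simp add: rotation_invariant_prob_def)
  note idL = rotation_invariant_prob_measurable(1)[OF L]
  note spL = rotation_invariant_prob_measurable(2)[OF L]
  have sm: "signed_measure ?M \<mu>" and \<mu>1: "\<mu> (unit_ball N) = 1"
    using \<mu> by (auto simp: signed_prob_def)
  have P: "finite_measure P" "sets P = sets ?M" and Q: "finite_measure Q" "sets Q = sets ?M"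
    unfolding P_def Q_def
    using finite_measure_pos_part_measure sm signed_measure_uminus by auto
  have \<mu>_eq: "\<mu> A = measure P A - measure Q A" if "A \<in> sets ?M" for A
    unfolding P_def Q_def by (rule Jordan_decomposition[OF sm that])
  have spM: "space ?M = unit_ball N" by (simp add: space_restrict_space)
  then have one: "measure P (unit_ball N) - measure Q (unit_ball N) = 1"
    using \<mu>_eq[of "unit_ball N"] \<mu>1 by (metis sets.top)
  obtain R where R: "\<And>x. x \<in> unit_ball N \<Longrightarrow> norm x \<le> R"
    using bounded_unit_ball[OF N] by (auto simp: bounded_iff)

  have id: "(\<lambda>x. x) \<in> measurable ?M borel" by (intro measurable_restrict_space1) simp
  have km: "(\<lambda>((y, x), t). ?k x y t) \<in> borel_measurable ((?M \<Otimes>\<^sub>M ?M) \<Otimes>\<^sub>M L)"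
    unfolding case_prod_beta'
    by (intro powr_real_measurable borel_measurable_const borel_measurable_abs borel_measurable_inner
        borel_measurable_diff measurable_compose[OF measurable_snd idL]
        measurable_compose[OF measurable_compose[OF measurable_fst measurable_snd] id]
        measurable_compose[OF measurable_compose[OF measurable_fst measurable_fst] id])
  have kb: "\<bar>?k x y t\<bar> \<le> (2 * R) powr p"
    if "x \<in> space ?M" "y \<in> space ?M" "t \<in> space L" for x y t
  proof -
    have "\<bar>(x - y) \<bullet> t\<bar> \<le> norm (x - y) * norm t" by (rule Cauchy_Schwarz_ineq2)
    also have "\<dots> \<le> 2 * R"
      using that R[of x] R[of y] norm_triangle_ineq4[of x y] by (simp add: spM spL)
    finally show ?thesis using p by (simp add: powr_mono2)
  qed
  note avg = diff_energy_average[OF P Q L.finite_measure_axioms km kb]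
  have "energy p (unit_ball N) \<mu> = diff_energy P Q (\<lambda>x y. dist x y powr p)"
    by (rule energy_eq_diff_energy[OF sm bounded_unit_ball[OF N] p P Q \<mu>_eq])
  also have "\<dots> = diff_energy P Q (\<lambda>x y. ?b * (LINT t|L. ?k x y t))"
    by (simp add: dist_norm norm_powr_eq_spherical_average[OF L p])
  also have "\<dots> = ?b * (LINT t|L. diff_energy P Q (\<lambda>x y. ?k x y t))"
    by (simp add: diff_energy_cmult avg(1))
  finally have E: "energy p (unit_ball N) \<mu> = ?b * (LINT t|L. diff_energy P Q (\<lambda>x y. ?k x y t))" .

  have tnz: "t \<noteq> 0" if "t \<in> space L" for t using that by (auto simp: spL)
  have D0: "0 < dual_norm N t" if "t \<in> space L" for t
    by (rule dual_norm_pos[OF N R tnz[OF that]])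
  have "dual_norm N \<in> borel_measurable L"
    using measurable_compose[OF idL borel_measurable_continuous_onI[OF continuous_dual_norm[OF N R]]] .
  then have Dint: "integrable L (\<lambda>t. dual_norm N t powr p)"
  proof (intro integrable_bounded[OF L.finite_measure_axioms])
    show "\<bar>dual_norm N t powr p\<bar> \<le> R powr p" if "t \<in> space L" for t
      using dual_norm_le[OF N R, of t] D0[OF that] that p by (simp add: spL powr_mono2)
  qed simp
  \<comment> \<open>Strict positivity matters if \<open>\<mm> p\<close> is infinite: in the extended
    reals infinity times 0 is 0, and the bound would no longer be trivial.\<close>
  have "(LINT t|L. 0) < (LINT t|L. dual_norm N t powr p)"
    using Dint L.emeasure_space_1
    by (intro L.integral_less_AE_space AE_I2) (auto dest: less_imp_neq[OF D0])
  moreover have b: "0 < ?b"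
    using p unfolding b_const_def by (auto intro!: divide_pos_pos mult_pos_pos Gamma_real_pos)
  ultimately have c: "0 < ?b * (LINT t|L. dual_norm N t powr p)" by simp

  have proj: "\<exists>E. diff_energy P Q (\<lambda>x y. ?k x y t) = dual_norm N t powr p * E \<and> ereal E \<le> \<mm> p"
    if "t \<in> space L" for t
    by (rule diff_energy_projection_le[OF N p tnz[OF that] P Q one])
  show ?thesis
  proof (cases "\<mm> p")
    case PInf
    then have "\<mm> p * ereal (?b * (LINT t|L. dual_norm N t powr p)) = \<infinity>"
      using c by auto
    then show ?thesis by (simp only: ereal_less_eq)
  next
    case MInf
    \<comment> \<open>Impossible case: the sphere carries some \<open>t\<close>, and its projected
      energy is a real number below \<open>\<mm> p\<close>.\<close>
    then show ?thesis using proj L.not_empty by fastforce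
  next
    case (real m)
    have "(LINT t|L. diff_energy P Q (\<lambda>x y. ?k x y t)) \<le> (LINT t|L. m * dual_norm N t powr p)"
    proof (intro integral_mono avg(2) integrable_mult_right Dint)
      fix t assume "t \<in> space L"
      from proj[OF this] obtain E where
        "diff_energy P Q (\<lambda>x y. ?k x y t) = dual_norm N t powr p * E" "E \<le> m"
        using real by auto
      then show "diff_energy P Q (\<lambda>x y. ?k x y t) \<le> m * dual_norm N t powr p"
        by (simp add: mult.commute[of m] mult_left_mono)
    qed
    then have "?b * (LINT t|L. diff_energy P Q (\<lambda>x y. ?k x y t)) \<le> m * (?b * (LINT t|L. dual_norm N t powr p))"
      using b by (simp add: mult.left_commute)
    then show ?thesis unfolding E real by simp
  qed
qed

theorem proposition2p9:
  fixes N :: "real ^ 'n \<Rightarrow> real" and p :: real and L :: "(real ^ 'n) measure"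
  assumes "is_norm N"
    and "0 < p" and "p < 2"
    and "rotation_invariant_prob L"
  shows "max_energy p (unit_ball N)
         \<le> \<mm> p * ereal (b_const p CARD('n) * (LINT t|L. dual_norm N t powr p))"
  unfolding max_energy_def using energy_unit_ball_le[OF assms(1,2,4)] by (rule SUP_least)

end
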